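(* Let $1\le p\le\infty$ and let $(E_n)_{n=1}^\infty$ be a sequence of finite dimensional Banach spaces. If $(x_i)_{i=1}^\infty$ is a normalized 1-greedy basis for the space $(\oplus_{n=1}^\infty E_n)_{\ell_p}$ (where for $p=\infty$ this means the $c_0$-sum $(\oplus_{n=1}^\infty E_n)_{c_0}$), then $(x_i)_{i=1}^\infty$ is 1-equivalent to the standard unit vector basis of $\ell_p$ (of $c_0$ if $p=\infty$); that is, for every finitely supported real sequence $(a_i)$, $\|\sum_i a_ix_i\|=(\sum_i|a_i|^p)^{1/p}$ if $p<\infty$, and $\|\sum_i a_ix_i\|=\max_i|a_i|$ if $p=\infty$.
   Context: All Banach spaces are real. For $1\le p<\infty$, $(\oplus_{n=1}^\infty E_n)_{\ell_p}$ is the space of sequences $(v_n)$ with $v_n\in E_n$ and norm $\|(v_n)\|=(\sum_n\|v_n\|^p)^{1/p}<\infty$; $(\oplus_{n=1}^\infty E_n)_{c_0}$ is the space of sequences $(v_n)$ with $v_n\in E_n$ and $\|v_n\|\to 0$, with norm $\sup_n\|v_n\|$. A basis is normalized if all its vectors have norm 1. Let $(x_i)_{i=1}^\infty$ be a Schauder basis of a Banach space $X$ with biorthogonal functionals $(x_i^* )$. For $x\in X$ and $n\ge 1$ put $$\sigma_n(x)=\inf\Big\{\Big\|x-\sum_{i\in A}a_ix_i\Big\| : (a_i)\subset\mathbb{R},\ A\subset\mathbb{N},\ |A|\le n\Big\}.$$ A set $A_n(x)\subset\mathbb{N}$ with $|A_n(x)|=n$ is a choice of indices of $n$ largest coefficients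 of $x$ if $\min\{|x_i^*(x)|: i\in A_n(x)\}\ge\max\{|x_i^*(x)|: i\in\mathbb{N}\setminus A_n(x)\}$, and then $G_n(x)=\sum_{i\in A_n(x)}x_i^*(x)x_i$ is called an $n$-th greedy approximant to $x$. The basis $(x_i)$ is greedy with constant $C$ if $\|x-G_n(x)\|\le C\,\sigma_n(x)$ for all $x\in X$, $n\ge 1$ (and every such $G_n(x)$); it is 1-greedy if this holds with $C=1$. *)

theory Defs
  imports "HOL-Analysis.Analysis" "HOL-Library.Function_Algebras"
begin

instantiation "fun" :: (type, real_vector) real_vector
begin

definition scaleR_fun :: "real \<Rightarrow> ('a \<Rightarrow> 'b) \<Rightarrow> 'a \<Rightarrow> 'b" where
  "scaleR_fun c f = (\<lambda>x. c *\<^sub>R f x)"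

instance
  by standard (auto simp: scaleR_fun_def fun_eq_iff scaleR_add_right scaleR_add_left)

end

lemma scaleR_fun_apply [simp]: "(c *\<^sub>R f) x = c *\<^sub>R f x"
  by (simp add: scaleR_fun_def)

text \<open>
  The spaces \<open>E\<^sub>n\<close> and their sums vary with parameters, so a normed space is given by a
  carrier \<open>V\<close>, a linear subspace of an ambient real vector space, and a function \<open>N\<close> whose
  values matter only on \<open>V\<close>. The ambient space carries no norm of its own.
\<close>

definition normed_space_on :: "'a::real_vector set \<Rightarrow> ('a \<Rightarrow> real) \<Rightarrow> bool" where
  "normed_space_on V N \<longleftrightarrow>
     subspace V \<and>
     (\<forall>v\<in>V. 0 \<le> N v) \<and>
     (\<forall>v\<in>V. N v = 0 \<longleftrightarrow> v = 0) \<and>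
     (\<forall>c. \<forall>v\<in>V. N (c *\<^sub>R v) = \<bar>c\<bar> * N v) \<and>
     (\<forall>u\<in>V. \<forall>v\<in>V. N (u + v) \<le> N u + N v)"

text \<open>Completeness is automatic in finite dimension and therefore not listed.\<close>

definition finite_dim_banach_on :: "'a::real_vector set \<Rightarrow> ('a \<Rightarrow> real) \<Rightarrow> bool" where
  "finite_dim_banach_on V N \<longleftrightarrow> normed_space_on V N \<and> (\<exists>B. finite B \<and> span B = V)"

text \<open>The \<open>\<ell>\<^sub>p\<close>-sum of the spaces \<open>(V n, N n)\<close>; for \<open>p = \<infinity>\<close> it is the \<open>c\<^sub>0\<close>-sum.\<close>

definition lp_sum :: "ereal \<Rightarrow> (nat \<Rightarrow> 'a::real_vector set) \<Rightarrow> (nat \<Rightarrow> 'a \<Rightarrow> real) \<Rightarrow> (nat \<Rightarrow> 'a) set" where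
  "lp_sum p V N = {v. (\<forall>n. v n \<in> V n) \<and>
     (if p = \<infinity> then (\<lambda>n. N n (v n)) \<longlonglongrightarrow> 0
      else summable (\<lambda>n. N n (v n) powr real_of_ereal p))}"

definition lp_sum_norm :: "ereal \<Rightarrow> (nat \<Rightarrow> 'a \<Rightarrow> real) \<Rightarrow> (nat \<Rightarrow> 'a) \<Rightarrow> real" where
  "lp_sum_norm p N v =
     (if p = \<infinity> then (SUP n. N n (v n))
      else (\<Sum>n. N n (v n) powr real_of_ereal p) powr (1 / real_of_ereal p))"

definition basis_expansion :: "('a::real_vector \<Rightarrow> real) \<Rightarrow> (nat \<Rightarrow> 'a) \<Rightarrow> 'a \<Rightarrow> (nat \<Rightarrow> real) \<Rightarrow> bool" where
  "basis_expansion N x v a \<longleftrightarrow> (\<lambda>n. N (v - (\<Sum>i<n. a i *\<^sub>R x i))) \<longlonglongrightarrow> 0"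

definition schauder_basis_on :: "'a::real_vector set \<Rightarrow> ('a \<Rightarrow> real) \<Rightarrow> (nat \<Rightarrow> 'a) \<Rightarrow> bool" where
  "schauder_basis_on X N x \<longleftrightarrow> (\<forall>i. x i \<in> X) \<and> (\<forall>v\<in>X. \<exists>!a. basis_expansion N x v a)"

text \<open>
  \<open>basis_coord N x i\<close> is the biorthogonal functional \<open>x\<^sub>i\<^sup>*\<close>; it is meaningful on the
  carrier of which \<open>x\<close> is a Schauder basis.
\<close>

definition basis_coord :: "('a::real_vector \<Rightarrow> real) \<Rightarrow> (nat \<Rightarrow> 'a) \<Rightarrow> nat \<Rightarrow> 'a \<Rightarrow> real" where
  "basis_coord N x i v = (THE a. basis_expansion N x v a) i"

lemma basis_coord_basis:
  assumes "normed_space_on X N" "schauder_basis_on X N x"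
  shows "basis_coord N x i (x j) = (if i = j then 1 else 0)"
proof -
  let ?a = "\<lambda>i. if i = j then 1 else (0::real)"
  have x: "x j \<in> X" and ex1: "\<exists>!a. basis_expansion N x (x j) a"
    using assms(2) by (auto simp: schauder_basis_on_def)
  have "N 0 = 0"
    using assms(1) by (auto simp: normed_space_on_def subspace_0)
  moreover have "(\<Sum>i<n. ?a i *\<^sub>R x i) = x j" if "n > j" for n
  proof -
    have "(\<Sum>i<n. ?a i *\<^sub>R x i) = (\<Sum>i<n. if i = j then x i else 0)"
      by (rule sum.cong) auto
    then show ?thesis using that by simp
  qed
  ultimately have "eventually (\<lambda>n. N (x j - (\<Sum>i<n. ?a i *\<^sub>R x i)) = 0) sequentially"
    unfolding eventually_sequentially
    by (metis (no_types, lifting) diff_self less_eq_Suc_le)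
  then have "basis_expansion N x (x j) ?a"
    unfolding basis_expansion_def by (rule tendsto_eventually)
  with ex1 have "(THE a. basis_expansion N x (x j) a) = ?a"
    by (simp add: the1_equality)
  then show ?thesis
    by (simp add: basis_coord_def)
qed

definition best_approx_error :: "('a::real_vector \<Rightarrow> real) \<Rightarrow> (nat \<Rightarrow> 'a) \<Rightarrow> nat \<Rightarrow> 'a \<Rightarrow> real" where
  "best_approx_error N x n v =
     Inf {N (v - (\<Sum>i\<in>A. a i *\<^sub>R x i)) | (a :: nat \<Rightarrow> real) A. finite A \<and> card A \<le> n}"

definition largest_coeffs :: "('a::real_vector \<Rightarrow> real) \<Rightarrow> (nat \<Rightarrow> 'a) \<Rightarrow> nat \<Rightarrow> 'a \<Rightarrow> nat set \<Rightarrow> bool" where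
  "largest_coeffs N x n v A \<longleftrightarrow> finite A \<and> card A = n \<and>
     (\<forall>i\<in>A. \<forall>j\<in>-A. \<bar>basis_coord N x j v\<bar> \<le> \<bar>basis_coord N x i v\<bar>)"

definition greedy_approximant :: "('a::real_vector \<Rightarrow> real) \<Rightarrow> (nat \<Rightarrow> 'a) \<Rightarrow> 'a \<Rightarrow> nat set \<Rightarrow> 'a" where
  "greedy_approximant N x v A = (\<Sum>i\<in>A. basis_coord N x i v *\<^sub>R x i)"

definition greedy_basis_on :: "real \<Rightarrow> 'a::real_vector set \<Rightarrow> ('a \<Rightarrow> real) \<Rightarrow> (nat \<Rightarrow> 'a) \<Rightarrow> bool" where
  "greedy_basis_on C X N x \<longleftrightarrow> schauder_basis_on X N x \<and>
     (\<forall>v\<in>X. \<forall>n\<ge>1. \<forall>A. largest_coeffs N x n v A \<longrightarrow>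
        N (v - greedy_approximant N x v A) \<le> C * best_approx_error N x n v)"

end

theory Submission
  imports Defs "HOL-Library.Diagonal_Subsequence"
begin

text \<open>
  Let \<open>f a b = (a\<^sup>p + b\<^sup>p)\<^sup>1\<^sup>/\<^sup>p\<close> (\<open>max a b\<close> for \<open>p = \<infinity>\<close>). Greedy approximation with a single term
  already shows that \<open>\<parallel>v + t x\<^sub>j\<parallel>\<close>, for \<open>v\<close> a finite combination with coefficients bounded by \<open>\<bar>t\<bar>\<close>,
  depends neither on the sign of \<open>t\<close> nor on the index \<open>j\<close> outside the support of \<open>v\<close>. If some
  subsequence of the basis tends to \<open>0\<close> in every coordinate \<open>E\<^sub>n\<close>, we may let \<open>j\<close> run through it
  and obtain \<open>\<parallel>v + t x\<^sub>j\<parallel> = f \<parallel>v\<parallel> \<bar>t\<bar>\<close>; removing the largest coefficients one by one then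
  computes the norm of every finite combination.

  Since the \<open>E\<^sub>n\<close> are finite dimensional, some subsequence converges coordinatewise to a limit
  \<open>y\<close>, and it remains to see that \<open>y = 0\<close>. For \<open>p < \<infinity>\<close> the limit \<open>y\<close> lies in the space,
  and the iterated limit of \<open>\<parallel>x\<^sub>l + x\<^sub>k\<parallel> = \<parallel>x\<^sub>l - x\<^sub>k\<parallel>\<close> gives
  \<open>f \<parallel>2y\<parallel> s = f 0 s\<close> with \<open>s = lim \<parallel>x\<^sub>k - y\<parallel>\<close>. For \<open>p = \<infinity>\<close>, where \<open>y\<close> may
  lie outside the \<open>c\<^sub>0\<close>-sum, replacing pairs of basis vectors by differences \<open>x\<^sub>k - x\<^sub>l\<close> shows
  that sums of \<open>2m\<close> basis vectors have norm at most \<open>2\<close>, whereas a coordinate \<open>y\<^sub>n \<noteq> 0\<close> would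
  make such sums grow linearly in \<open>m\<close>.
\<close>

subsection \<open>Normed carriers and 1-greedy bases\<close>

lemma null_dominated:
  fixes a b :: "nat \<Rightarrow> real"
  assumes "\<And>k. 0 \<le> a k" "\<And>k. a k \<le> b k" "b \<longlonglongrightarrow> 0"
  shows "a \<longlonglongrightarrow> 0"
  using real_tendsto_sandwich[OF _ _ tendsto_const assms(3)] assms(1,2) by simp

locale normed_carrier =
  fixes X :: "'a::real_vector set" and nr :: "'a \<Rightarrow> real"
  assumes normed: "normed_space_on X nr"
begin

lemma subspace_X: "subspace X"
  using normed by (simp add: normed_space_on_def)

lemmas zero_mem = subspace_0[OF subspace_X]
  and add_mem = subspace_add[OF subspace_X]
  and diff_mem = subspace_diff[OF subspace_X]
  and scale_mem = subspace_scale[OF subspace_X]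
  and sum_mem = subspace_sum[OF subspace_X]

lemma nr_nonneg: "v \<in> X \<Longrightarrow> 0 \<le> nr v"
  and nr_eq_0: "v \<in> X \<Longrightarrow> nr v = 0 \<longleftrightarrow> v = 0"
  and nr_scale: "v \<in> X \<Longrightarrow> nr (c *\<^sub>R v) = \<bar>c\<bar> * nr v"
  and nr_triangle: "u \<in> X \<Longrightarrow> v \<in> X \<Longrightarrow> nr (u + v) \<le> nr u + nr v"
  using normed by (auto simp: normed_space_on_def)

lemma nr_zero: "nr 0 = 0"
  using nr_eq_0[OF zero_mem] by simp

lemma nr_minus: "v \<in> X \<Longrightarrow> nr (- v) = nr v"
  using nr_scale[of v "-1"] by simp

lemma nr_diff_commute: "u \<in> X \<Longrightarrow> v \<in> X \<Longrightarrow> nr (u - v) = nr (v - u)"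
  using nr_minus[OF diff_mem, of v u] by simp

lemma nr_diff_triangle: "u \<in> X \<Longrightarrow> v \<in> X \<Longrightarrow> nr (u - v) \<le> nr u + nr v"
  using nr_triangle[of u "(-1) *\<^sub>R v"] scale_mem[of v "-1"] nr_minus[of v] by simp

lemma nr_reverse_triangle:
  assumes "u \<in> X" "v \<in> X"
  shows "\<bar>nr u - nr v\<bar> \<le> nr (u - v)"
  using nr_triangle[OF diff_mem[OF assms] assms(2)]
    nr_triangle[OF diff_mem[OF assms(2,1)] assms(1)] nr_diff_commute[OF assms] by simp

lemma nr_sum_le: "(\<And>i. i \<in> S \<Longrightarrow> g i \<in> X) \<Longrightarrow> nr (\<Sum>i\<in>S. g i) \<le> (\<Sum>i\<in>S. nr (g i))"
proof (induction S rule: infinite_finite_induct)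
  case (insert i S)
  then show ?case using nr_triangle[of "g i" "\<Sum>i\<in>S. g i"] sum_mem[of S g] by simp
qed (simp_all add: nr_zero)

text \<open>Bolzano-Weierstrass in finite dimension, by induction on the spanning set. A new vector
  \<open>b\<close> outside the old span has positive distance from it, so its coefficients along
  \<open>u\<close> are bounded; a subsequence makes them converge, and the induction hypothesis
  handles the remainders in the old span.\<close>

lemma bounded_subseq_in_span:
  assumes "finite B" "B \<subseteq> X" "\<And>k::nat. u k \<in> span B" "\<And>k. nr (u k) \<le> C"
  shows "\<exists>r y. strict_mono r \<and> y \<in> span B \<and> (\<lambda>k. nr (u (r k) - y)) \<longlonglongrightarrow> 0"
  using assms
proof (induction B arbitrary: u C rule: finite_induct)
  case empty
  then show ?case
    by (intro exI[of _ id] exI[of _ 0]) (auto simp: strict_mono_def nr_zero)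
next
  case (insert b B)
  then have b: "b \<in> X" and BX: "B \<subseteq> X" by auto
  have spX: "span B \<subseteq> X"
    using BX subspace_X by (rule span_minimal)
  show ?case
  proof (cases "b \<in> span B")
    case True
    then have "span (insert b B) = span B" by (rule span_redundant)
    with insert.IH[OF BX, of u C] insert.prems show ?thesis by simp
  next
    case False
    \<comment> \<open>If the distance were \<open>0\<close>, vectors of \<open>span B\<close> would
      approach \<open>b\<close>. They are bounded, so the induction hypothesis gives a limit in
      \<open>span B\<close>, which must be \<open>b\<close>.\<close>
    have "\<exists>d>0. \<forall>w\<in>span B. d \<le> nr (b - w)"
    proof (rule ccontr)
      assume "\<not> ?thesis"
      then have *: "\<And>d::real. d > 0 \<Longrightarrow> \<exists>w\<in>span B. nr (b - w) < d"
        by (meson not_le)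
      have "\<exists>w\<in>span B. nr (b - w) < inverse (real (Suc k))" for k :: nat
        by (rule *) simp
      then have "\<forall>k::nat. \<exists>w. w \<in> span B \<and> nr (b - w) < inverse (real (Suc k))"
        by blast
      from choice[OF this] obtain w where w: "\<And>k::nat. w k \<in> span B"
        and wb: "\<And>k. nr (b - w k) < inverse (real (Suc k))"
        by blast
      have wX: "w k \<in> X" for k using w spX by auto
      have lim: "(\<lambda>k. nr (b - w k)) \<longlonglongrightarrow> 0"
        using nr_nonneg[OF diff_mem[OF b wX]] less_imp_le[OF wb] LIMSEQ_inverse_real_of_nat
        by (rule null_dominated)
      have "nr (w k) \<le> nr b + 1" for k
      proof -
        have "inverse (real (Suc k)) \<le> 1" by (simp add: field_simps)
        then show ?thesis
          using nr_reverse_triangle[OF b wX, of k] wb[of k] by linarith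
      qed
      then have "\<exists>r y. strict_mono r \<and> y \<in> span B \<and> (\<lambda>k. nr (w (r k) - y)) \<longlonglongrightarrow> 0"
        by (rule insert.IH[OF BX w])
      then obtain r y where r: "strict_mono r" and y: "y \<in> span B"
        and ly: "(\<lambda>k. nr (w (r k) - y)) \<longlonglongrightarrow> 0" by blast
      have yX: "y \<in> X" using y spX by auto
      have "nr (b - y) \<le> nr (b - w (r k)) + nr (w (r k) - y)" for k
        using nr_triangle[OF diff_mem[OF b wX] diff_mem[OF wX yX], of "r k" "r k"] by simp
      moreover have "(\<lambda>k. nr (b - w (r k)) + nr (w (r k) - y)) \<longlonglongrightarrow> 0"
        using tendsto_add[OF LIMSEQ_subseq_LIMSEQ[OF lim r] ly] by (simp add: o_def)
      ultimately have "nr (b - y) \<le> 0"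
        by (intro LIMSEQ_le_const[of "\<lambda>k. nr (b - w (r k)) + nr (w (r k) - y)"]) auto
      then have "b = y"
        using nr_nonneg[OF diff_mem[OF b yX]] nr_eq_0[OF diff_mem[OF b yX]] by simp
      with y False show False by simp
    qed
    then obtain d where d: "d > 0" "\<And>w. w \<in> span B \<Longrightarrow> d \<le> nr (b - w)" by blast
    have "\<forall>k. \<exists>c. u k - c *\<^sub>R b \<in> span B"
      using insert.prems(2) by (simp add: span_insert)
    then obtain c where c: "\<And>k. u k - c k *\<^sub>R b \<in> span B" by metis
    have uX: "u k \<in> X" for k
      using insert.prems(2)[of k] span_minimal[OF insert.prems(1) subspace_X] by auto
    have cb: "\<bar>c k\<bar> \<le> C / d" for k
    proof (cases "c k = 0")
      case True
      have "0 \<le> C" using nr_nonneg[OF uX] insert.prems(3) order_trans by blast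
      with True d show ?thesis by simp
    next
      case False
      \<comment> \<open>This vector is \<open>b - (1 / c k) *\<^sub>R u k\<close>, so its distance
        from \<open>b\<close> is the norm of \<open>u k\<close> divided by the absolute value of
        \<open>c k\<close>.\<close>
      have "(-(1 / c k)) *\<^sub>R (u k - c k *\<^sub>R b) \<in> span B"
        by (intro span_scale c)
      from d(2)[OF this] have "d \<le> nr ((1 / c k) *\<^sub>R u k)"
        using False by (simp add: algebra_simps)
      then have "d \<le> nr (u k) / \<bar>c k\<bar>"
        using nr_scale[OF uX] by simp
      then have "\<bar>c k\<bar> * d \<le> nr (u k)" using False by (simp add: field_simps)
      with insert.prems(3)[of k] d show ?thesis by (simp add: field_simps)
    qed
    have "bounded (range c)" using cb by (auto simp: bounded_iff)
    then obtain l r1 where r1: "strict_mono r1" and l: "(c \<circ> r1) \<longlonglongrightarrow> l"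
      using bounded_imp_convergent_subsequence by blast
    define w where "w k = u (r1 k) - c (r1 k) *\<^sub>R b" for k
    have wB: "w k \<in> span B" for k by (simp add: w_def c)
    have wX: "w k \<in> X" for k using wB spX by auto
    have "nr (w k) \<le> C + C / d * nr b" for k
      unfolding w_def using nr_diff_triangle[OF uX scale_mem[OF b], of "r1 k" "c (r1 k)"]
        insert.prems(3)[of "r1 k"] mult_right_mono[OF cb nr_nonneg[OF b], of "r1 k"]
        nr_scale[OF b, of "c (r1 k)"] by linarith
    then have "\<exists>r y. strict_mono r \<and> y \<in> span B \<and> (\<lambda>k. nr (w (r k) - y)) \<longlonglongrightarrow> 0"
      by (rule insert.IH[OF BX wB])
    then obtain r2 y where r2: "strict_mono r2" and y: "y \<in> span B"
      and ly: "(\<lambda>k. nr (w (r2 k) - y)) \<longlonglongrightarrow> 0" by blast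
    have yX: "y \<in> X" using y spX by auto
    have lc: "(\<lambda>k. c (r1 (r2 k))) \<longlonglongrightarrow> l"
      using LIMSEQ_subseq_LIMSEQ[OF l r2] by (simp add: o_def)
    define z where "z = l *\<^sub>R b + y"
    have zX: "z \<in> X" unfolding z_def using b yX by (intro add_mem scale_mem)
    have "\<exists>k. z - k *\<^sub>R b \<in> span B" by (rule exI[of _ l]) (simp add: z_def y)
    then have zB: "z \<in> span (insert b B)" by (simp add: span_insert)
    have "nr (u (r1 (r2 k)) - z) \<le> nr (w (r2 k) - y) + \<bar>c (r1 (r2 k)) - l\<bar> * nr b" for k
    proof -
      have "u (r1 (r2 k)) - z = (w (r2 k) - y) + (c (r1 (r2 k)) - l) *\<^sub>R b"
        by (simp add: w_def z_def algebra_simps)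
      then show ?thesis
        using nr_triangle[OF diff_mem[OF wX yX] scale_mem[OF b]] nr_scale[OF b] by metis
    qed
    moreover have "(\<lambda>k. nr (w (r2 k) - y) + \<bar>c (r1 (r2 k)) - l\<bar> * nr b) \<longlonglongrightarrow> 0"
      using tendsto_add[OF ly tendsto_mult_left_zero[OF tendsto_rabs_zero[OF LIM_zero[OF lc]]]]
      by simp
    ultimately have "(\<lambda>k. nr (u (r1 (r2 k)) - z)) \<longlonglongrightarrow> 0"
      by (rule null_dominated[OF nr_nonneg[OF diff_mem[OF uX zX]]])
    then show ?thesis
      using strict_mono_o[OF r1 r2] zB by (intro exI[of _ "r1 \<circ> r2"] exI[of _ z]) (auto simp: o_def)
  qed
qed

end

section \<open>Exchanging basis vectors by one-term greedy approximation\<close>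

locale one_greedy = normed_carrier X nr
  for X :: "'a::real_vector set" and nr :: "'a \<Rightarrow> real" +
  fixes x :: "nat \<Rightarrow> 'a"
  assumes greedy: "greedy_basis_on 1 X nr x"
    and unit: "\<And>i. nr (x i) = 1"
begin

lemma schauder: "schauder_basis_on X nr x"
  using greedy by (simp add: greedy_basis_on_def)

lemma x_mem: "x i \<in> X"
  using schauder by (simp add: schauder_basis_on_def)

lemma comb_mem: "(\<Sum>i\<in>S. a i *\<^sub>R x i) \<in> X"
  by (intro sum_mem scale_mem x_mem)

text \<open>The partial sums of the zero-extended coefficients eventually equal the vector itself,
  and the uniqueness of expansions identifies them as its coordinates.\<close>

lemma coord_comb:
  assumes "finite S"
  shows "basis_coord nr x i (\<Sum>j\<in>S. a j *\<^sub>R x j) = (if i \<in> S then a i else 0)"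
proof -
  let ?v = "\<Sum>j\<in>S. a j *\<^sub>R x j" and ?a = "\<lambda>i. if i \<in> S then a i else 0"
  have "eventually (\<lambda>n. nr (?v - (\<Sum>i<n. ?a i *\<^sub>R x i)) = 0) sequentially"
    unfolding eventually_sequentially
  proof (intro exI allI impI)
    \<comment> \<open>Inserting \<open>0\<close> keeps \<open>Max\<close> meaningful when
      \<open>S\<close> is empty.\<close>
    fix n assume n: "Suc (Max (insert 0 S)) \<le> n"
    have "j < n" if "j \<in> S" for j
    proof -
      have "j \<le> Max (insert 0 S)" using that assms by (intro Max_ge) auto
      with n show ?thesis by linarith
    qed
    then have "S \<subseteq> {..<n}" by auto
    then have "(\<Sum>i<n. ?a i *\<^sub>R x i) = ?v"
      by (intro sum.mono_neutral_cong_right) auto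
    then show "nr (?v - (\<Sum>i<n. ?a i *\<^sub>R x i)) = 0" by (simp add: nr_zero)
  qed
  then have "basis_expansion nr x ?v ?a"
    unfolding basis_expansion_def by (rule tendsto_eventually)
  then have "(THE a. basis_expansion nr x ?v a) = ?a"
    using schauder comb_mem by (intro the1_equality) (auto simp: schauder_basis_on_def)
  then show ?thesis by (simp add: basis_coord_def)
qed

text \<open>
  In \<open>v + t x\<^sub>j + s x\<^sub>k\<close> both \<open>{j}\<close> and \<open>{k}\<close> are choices of a largest coefficient, so the
  greedy removal of \<open>x\<^sub>k\<close> is at least as good as the removal of \<open>x\<^sub>j\<close>.
\<close>

lemma swap_le:
  assumes "finite S" "j \<notin> S" "k \<notin> S" "j \<noteq> k" "\<And>i. i \<in> S \<Longrightarrow> \<bar>a i\<bar> \<le> \<bar>t\<bar>" "\<bar>s\<bar> = \<bar>t\<bar>"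
  shows "nr ((\<Sum>i\<in>S. a i *\<^sub>R x i) + t *\<^sub>R x j) \<le> nr ((\<Sum>i\<in>S. a i *\<^sub>R x i) + s *\<^sub>R x k)"
proof -
  let ?v = "\<Sum>i\<in>S. a i *\<^sub>R x i"
  let ?b = "\<lambda>i. if i = j then t else if i = k then s else a i"
  define z where "z = (\<Sum>i\<in>insert j (insert k S). ?b i *\<^sub>R x i)"
  have "(\<Sum>i\<in>S. ?b i *\<^sub>R x i) = ?v"
    using assms(2,3) by (intro sum.cong) auto
  then have z: "z = ?v + t *\<^sub>R x j + s *\<^sub>R x k"
    unfolding z_def using assms(1-4) by simp
  have coord: "basis_coord nr x i z = (if i \<in> insert j (insert k S) then ?b i else 0)" for i
    unfolding z_def using assms(1) by (intro coord_comb) auto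
  have "largest_coeffs nr x 1 z {k}"
    using assms by (auto simp: largest_coeffs_def coord)
  moreover have "z \<in> X" unfolding z_def by (rule comb_mem)
  ultimately have "nr (z - greedy_approximant nr x z {k}) \<le> best_approx_error nr x 1 z"
    using greedy unfolding greedy_basis_on_def by auto
  moreover have "z - greedy_approximant nr x z {k} = ?v + t *\<^sub>R x j"
    using assms(4) coord[of k] unfolding greedy_approximant_def by (simp add: z)
  moreover have "best_approx_error nr x 1 z \<le> nr (z - (\<Sum>i\<in>{j}. t *\<^sub>R x i))"
    unfolding best_approx_error_def
  proof (rule cInf_lower)
    show "bdd_below {nr (z - (\<Sum>i\<in>A. a i *\<^sub>R x i)) |a A. finite A \<and> card A \<le> 1}"
      using nr_nonneg[OF diff_mem[OF \<open>z \<in> X\<close> comb_mem]] by (intro bdd_belowI[of _ 0]) blast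
  qed (rule CollectI, intro exI[of _ "\<lambda>_. t"] exI[of _ "{j}"], simp)
  ultimately show ?thesis by (simp add: z)
qed

text \<open>Two applications of \<open>swap_le\<close> give equality for distinct indices. Comparing
  both sides with a third index \<open>l\<close> also admits \<open>j = k\<close>, so a mere change
  of sign is included.\<close>

lemma swap:
  assumes "finite S" "j \<notin> S" "k \<notin> S" "\<And>i. i \<in> S \<Longrightarrow> \<bar>a i\<bar> \<le> \<bar>t\<bar>" "\<bar>s\<bar> = \<bar>t\<bar>"
  shows "nr ((\<Sum>i\<in>S. a i *\<^sub>R x i) + t *\<^sub>R x j) = nr ((\<Sum>i\<in>S. a i *\<^sub>R x i) + s *\<^sub>R x k)"
proof -
  obtain l where l: "l \<notin> insert j (insert k S)"
    using assms(1) ex_new_if_finite[of "insert j (insert k S)"] by auto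
  have eq: "nr ((\<Sum>i\<in>S. a i *\<^sub>R x i) + t *\<^sub>R x l) = nr ((\<Sum>i\<in>S. a i *\<^sub>R x i) + s' *\<^sub>R x m)"
    if "m \<notin> S" "m \<noteq> l" "\<bar>s'\<bar> = \<bar>t\<bar>" for m s'
  proof (rule antisym)
    show "nr ((\<Sum>i\<in>S. a i *\<^sub>R x i) + t *\<^sub>R x l) \<le> nr ((\<Sum>i\<in>S. a i *\<^sub>R x i) + s' *\<^sub>R x m)"
      using assms(1,4) that l by (intro swap_le) auto
    show "nr ((\<Sum>i\<in>S. a i *\<^sub>R x i) + s' *\<^sub>R x m) \<le> nr ((\<Sum>i\<in>S. a i *\<^sub>R x i) + t *\<^sub>R x l)"
      using assms(1,4) that l by (intro swap_le) auto
  qed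
  show ?thesis
    using eq[of j t] eq[of k s] assms(2,3,5) l by auto
qed

end

subsection \<open>Sums of finite-dimensional spaces\<close>

definition head :: "nat \<Rightarrow> (nat \<Rightarrow> 'b::zero) \<Rightarrow> nat \<Rightarrow> 'b" where
  "head M v = (\<lambda>n. if n < M then v n else 0)"

definition tail :: "nat \<Rightarrow> (nat \<Rightarrow> 'b::zero) \<Rightarrow> nat \<Rightarrow> 'b" where
  "tail M v = (\<lambda>n. if n < M then 0 else v n)"

lemma head_plus_tail: "head M v + tail M v = (v :: nat \<Rightarrow> 'b::monoid_add)"
  by (auto simp: head_def tail_def fun_eq_iff)

text \<open>
  \<open>f\<close> combines the norms of two sequences with disjoint supports; \<open>D\<close> and \<open>nn\<close> matter only for
  nonnegative sequences.
\<close>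

locale seq_norm =
  fixes D :: "(nat \<Rightarrow> real) set" and nn :: "(nat \<Rightarrow> real) \<Rightarrow> real" and f :: "real \<Rightarrow> real \<Rightarrow> real"
  assumes D_finite: "(\<And>n. 0 \<le> g n) \<Longrightarrow> finite {n. g n \<noteq> 0} \<Longrightarrow> g \<in> D"
    and D_mono: "g \<in> D \<Longrightarrow> (\<And>n. 0 \<le> h n) \<Longrightarrow> (\<And>n. h n \<le> g n) \<Longrightarrow> h \<in> D"
    and nn_mono: "g \<in> D \<Longrightarrow> (\<And>n. 0 \<le> h n) \<Longrightarrow> (\<And>n. h n \<le> g n) \<Longrightarrow> nn h \<le> nn g"
    and D_add: "g \<in> D \<Longrightarrow> h \<in> D \<Longrightarrow> (\<And>n. 0 \<le> g n) \<Longrightarrow> (\<And>n. 0 \<le> h n) \<Longrightarrow> g + h \<in> D"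
    and nn_add: "g \<in> D \<Longrightarrow> h \<in> D \<Longrightarrow> (\<And>n. 0 \<le> g n) \<Longrightarrow> (\<And>n. 0 \<le> h n) \<Longrightarrow> nn (g + h) \<le> nn g + nn h"
    and D_scale: "g \<in> D \<Longrightarrow> (\<And>n. 0 \<le> g n) \<Longrightarrow> 0 \<le> c \<Longrightarrow> c *\<^sub>R g \<in> D"
    and nn_scale: "g \<in> D \<Longrightarrow> (\<And>n. 0 \<le> g n) \<Longrightarrow> 0 \<le> c \<Longrightarrow> nn (c *\<^sub>R g) = c * nn g"
    and nn_single: "0 \<le> c \<Longrightarrow> nn (\<lambda>n. if n = m then c else 0) = c"
    and nn_tail: "g \<in> D \<Longrightarrow> (\<And>n. 0 \<le> g n) \<Longrightarrow> (\<lambda>M. nn (tail M g)) \<longlonglongrightarrow> 0"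
    and nn_split: "g \<in> D \<Longrightarrow> (\<And>n. 0 \<le> g n) \<Longrightarrow> nn g = f (nn (head M g)) (nn (tail M g))"
begin

lemma coord_le_nn:
  assumes "g \<in> D" "\<And>n. 0 \<le> g n"
  shows "g m \<le> nn g"
  using nn_mono[OF assms(1), of "\<lambda>n. if n = m then g m else 0"] nn_single[of "g m" m] assms(2)
  by auto

lemma nn_0: "nn 0 = 0"
  using nn_single[of 0] by (simp add: zero_fun_def)

text \<open>The two-dimensional norm \<open>f\<close> is the sequence norm restricted to the first two coordinates.\<close>

definition pair :: "real \<Rightarrow> real \<Rightarrow> nat \<Rightarrow> real" where
  "pair a b = (\<lambda>n. if n = 0 then a else if n = 1 then b else 0)"

lemma pair_nonneg: "0 \<le> a \<Longrightarrow> 0 \<le> b \<Longrightarrow> 0 \<le> pair a b n"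
  by (simp add: pair_def)

lemma D_pair: "0 \<le> a \<Longrightarrow> 0 \<le> b \<Longrightarrow> pair a b \<in> D"
  by (rule D_finite) (auto simp: pair_def intro: finite_subset[of _ "{0, 1}"])

text \<open>Splitting \<open>pair a b\<close> after its first coordinate leaves two one-entry
  sequences. Through this identity \<open>f\<close> inherits monotonicity and subadditivity from
  \<open>nn\<close>.\<close>

lemma f_eq_nn_pair:
  assumes "0 \<le> a" "0 \<le> b"
  shows "f a b = nn (pair a b)"
proof -
  have "head 1 (pair a b) = (\<lambda>n. if n = 0 then a else 0)"
    "tail 1 (pair a b) = (\<lambda>n. if n = 1 then b else 0)"
    by (auto simp: head_def tail_def pair_def fun_eq_iff)
  then show ?thesis
    using nn_split[OF D_pair[OF assms] pair_nonneg[OF assms], of 1] assms by (simp add: nn_single)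
qed

lemma f_mono:
  assumes "0 \<le> a" "a \<le> a'" "0 \<le> b" "b \<le> b'"
  shows "f a b \<le> f a' b'"
proof -
  have "nn (pair a b) \<le> nn (pair a' b')"
    using assms by (intro nn_mono D_pair) (auto simp: pair_def)
  then show ?thesis using assms by (simp add: f_eq_nn_pair)
qed

lemma f_0_left:
  assumes "0 \<le> b"
  shows "f 0 b = b"
proof -
  have "pair 0 b = (\<lambda>n. if n = 1 then b else 0)" by (auto simp: pair_def)
  with assms show ?thesis by (simp add: f_eq_nn_pair nn_single)
qed

lemma f_0_right:
  assumes "0 \<le> a"
  shows "f a 0 = a"
proof -
  have "pair a 0 = (\<lambda>n. if n = 0 then a else 0)" by (auto simp: pair_def)
  with assms show ?thesis by (simp add: f_eq_nn_pair nn_single)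
qed

lemma f_add_le:
  assumes "0 \<le> a" "0 \<le> b" "0 \<le> c" "0 \<le> d"
  shows "f (a + c) (b + d) \<le> f a b + f c d"
proof -
  have "pair (a + c) (b + d) = pair a b + pair c d" by (auto simp: pair_def fun_eq_iff)
  then show ?thesis
    using nn_add[OF D_pair D_pair pair_nonneg pair_nonneg] assms by (simp add: f_eq_nn_pair)
qed

text \<open>Increasing \<open>a'\<close> and \<open>b'\<close> by the distances to \<open>a\<close>
  and \<open>b\<close> dominates \<open>a\<close> and \<open>b\<close>; by subadditivity the
  increments cost at most their sum.\<close>

lemma f_lipschitz:
  assumes "0 \<le> a" "0 \<le> b" "0 \<le> a'" "0 \<le> b'"
  shows "\<bar>f a b - f a' b'\<bar> \<le> \<bar>a - a'\<bar> + \<bar>b - b'\<bar>"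
proof -
  have *: "f a b \<le> f a' b' + (\<bar>a - a'\<bar> + \<bar>b - b'\<bar>)"
    if "0 \<le> a" "0 \<le> b" "0 \<le> a'" "0 \<le> b'" for a b a' b'
  proof -
    let ?c = "\<bar>a - a'\<bar>" and ?d = "\<bar>b - b'\<bar>"
    have "f a b \<le> f (a' + ?c) (b' + ?d)" using that by (intro f_mono) auto
    also have "\<dots> \<le> f a' b' + f (0 + ?c) (?d + 0)" using that f_add_le[of a' b' ?c ?d] by simp
    also have "f (0 + ?c) (?d + 0) \<le> f 0 ?d + f ?c 0" by (intro f_add_le) auto
    finally show ?thesis by (simp add: f_0_left f_0_right)
  qed
  show ?thesis using *[of a b a' b'] *[of a' b' a b] assms by (simp add: abs_le_iff)
qed

lemma f_tendsto_right:
  assumes "s \<longlonglongrightarrow> s0" "\<And>k. 0 \<le> s k" "0 \<le> a"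
  shows "(\<lambda>k. f a (s k)) \<longlonglongrightarrow> f a s0"
proof (rule LIM_zero_cancel, rule Lim_null_comparison)
  have "0 \<le> s0" using assms(1,2) by (intro LIMSEQ_le_const) auto
  then show "\<forall>\<^sub>F k in sequentially. norm (f a (s k) - f a s0) \<le> \<bar>s k - s0\<bar>"
    using f_lipschitz[of a _ a s0] assms by (intro always_eventually) auto
  show "(\<lambda>k. \<bar>s k - s0\<bar>) \<longlonglongrightarrow> 0"
    using assms(1) by (intro tendsto_rabs_zero LIM_zero)
qed

end

section \<open>Heads, tails and coordinatewise limits in the sum\<close>

locale fin_dim_sum = seq_norm D nn f
  for D nn f +
  fixes V :: "nat \<Rightarrow> 'a::real_vector set" and N :: "nat \<Rightarrow> 'a \<Rightarrow> real"
  assumes fin_dim: "finite_dim_banach_on (V n) (N n)"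
begin

sublocale E: normed_carrier "V n" "N n" for n
  using fin_dim by unfold_locales (simp add: finite_dim_banach_on_def)

definition X :: "(nat \<Rightarrow> 'a) set" where
  "X = {v. (\<forall>n. v n \<in> V n) \<and> (\<lambda>n. N n (v n)) \<in> D}"

definition nr :: "(nat \<Rightarrow> 'a) \<Rightarrow> real" where
  "nr v = nn (\<lambda>n. N n (v n))"

lemma X_V: "v \<in> X \<Longrightarrow> v n \<in> V n"
  and X_D: "v \<in> X \<Longrightarrow> (\<lambda>n. N n (v n)) \<in> D"
  and X_nonneg: "v \<in> X \<Longrightarrow> 0 \<le> N n (v n)"
  by (auto simp: X_def E.nr_nonneg)

lemma coord_le: "v \<in> X \<Longrightarrow> N n (v n) \<le> nr v"
  unfolding nr_def by (rule coord_le_nn[OF X_D X_nonneg])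

lemma dominated:
  assumes "v \<in> X" "\<And>n. u n \<in> V n" "\<And>n. N n (u n) \<le> N n (v n)"
  shows "u \<in> X" "nr u \<le> nr v"
  using D_mono[OF X_D[OF assms(1)], of "\<lambda>n. N n (u n)"]
    nn_mono[OF X_D[OF assms(1)], of "\<lambda>n. N n (u n)"] assms(2,3)
  by (auto simp: X_def nr_def E.nr_nonneg)

lemma normed_space: "normed_space_on X nr"
proof -
  have zero: "0 \<in> X"
    by (auto simp: X_def E.zero_mem E.nr_zero intro: D_finite)
  have add: "u + v \<in> X \<and> nr (u + v) \<le> nr u + nr v" if "u \<in> X" "v \<in> X" for u v
  proof -
    let ?g = "\<lambda>n. N n (u n)" and ?h = "\<lambda>n. N n (v n)"
    have gh: "?g + ?h \<in> D" "nn (?g + ?h) \<le> nn ?g + nn ?h"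
      using that X_D X_nonneg by (auto intro: D_add nn_add)
    have uv: "u n + v n \<in> V n" for n using that by (auto intro: E.add_mem X_V)
    have le: "N n (u n + v n) \<le> (?g + ?h) n" for n
      using that by (simp add: E.nr_triangle X_V)
    have "nn (\<lambda>n. N n (u n + v n)) \<le> nn (?g + ?h)" "(\<lambda>n. N n (u n + v n)) \<in> D"
      by (rule nn_mono[OF gh(1) E.nr_nonneg[OF uv] le], rule D_mono[OF gh(1) E.nr_nonneg[OF uv] le])
    with order_trans[OF this(1) gh(2)] uv show ?thesis by (simp add: X_def nr_def)
  qed
  have scale: "c *\<^sub>R v \<in> X \<and> nr (c *\<^sub>R v) = \<bar>c\<bar> * nr v" if "v \<in> X" for c v
  proof -
    have "(\<lambda>n. N n (c *\<^sub>R v n)) = \<bar>c\<bar> *\<^sub>R (\<lambda>n. N n (v n))"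
      using that by (simp add: fun_eq_iff E.nr_scale X_V)
    with D_scale[OF X_D[OF that] X_nonneg[OF that], of "\<bar>c\<bar>"]
      nn_scale[OF X_D[OF that] X_nonneg[OF that], of "\<bar>c\<bar>"] that
    show ?thesis by (simp add: X_def nr_def E.scale_mem)
  qed
  have nonneg: "0 \<le> nr v" if "v \<in> X" for v
    using X_nonneg[OF that] coord_le[OF that] order_trans by blast
  have eq_0: "nr v = 0 \<longleftrightarrow> v = 0" if "v \<in> X" for v
  proof
    assume "nr v = 0"
    then have "N n (v n) = 0" for n
      using X_nonneg[OF that, of n] coord_le[OF that, of n] by simp
    then show "v = 0" using E.nr_eq_0[OF X_V[OF that]] by (simp add: fun_eq_iff)
  next
    assume "v = 0"
    then show "nr v = 0" using nn_0 by (simp add: nr_def E.nr_zero zero_fun_def)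
  qed
  show ?thesis
    unfolding normed_space_on_def subspace_def using zero add scale nonneg eq_0 by blast
qed

sublocale normed_carrier X nr
  by unfold_locales (rule normed_space)

lemma finite_support_mem:
  assumes "\<And>n. v n \<in> V n" "finite {n. v n \<noteq> 0}"
  shows "v \<in> X"
proof -
  have "{n. N n (v n) \<noteq> 0} \<subseteq> {n. v n \<noteq> 0}" by (auto simp: E.nr_zero)
  with assms show ?thesis
    by (auto simp: X_def E.nr_nonneg intro!: D_finite intro: finite_subset)
qed

lemma head_mem: "(\<And>n. v n \<in> V n) \<Longrightarrow> head M v \<in> X"
  by (rule finite_support_mem)
    (auto simp: head_def E.zero_mem intro: finite_subset[of _ "{..<M}"])

lemma tail_mem: "v \<in> X \<Longrightarrow> tail M v \<in> X"
  by (rule dominated(1)[of v]) (auto simp: tail_def E.zero_mem E.nr_zero X_V X_nonneg)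

lemma nr_head_le: "v \<in> X \<Longrightarrow> nr (head M v) \<le> nr v"
  by (rule dominated(2)[of v]) (auto simp: head_def E.zero_mem E.nr_zero X_V X_nonneg)

lemma norm_head: "(\<lambda>n. N n (head M v n)) = head M (\<lambda>n. N n (v n))"
  and norm_tail: "(\<lambda>n. N n (tail M v n)) = tail M (\<lambda>n. N n (v n))"
  by (auto simp: head_def tail_def E.nr_zero)

lemma nr_tail_tendsto: "v \<in> X \<Longrightarrow> (\<lambda>M. nr (tail M v)) \<longlonglongrightarrow> 0"
  unfolding nr_def norm_tail by (rule nn_tail[OF X_D X_nonneg])

text \<open>Each further coordinate costs at most its own norm. The crude bound suffices because
  \<open>M\<close> stays fixed while the coordinates tend to \<open>0\<close>.\<close>

lemma nr_head_le_sum: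
  assumes "\<And>n. v n \<in> V n"
  shows "nr (head M v) \<le> (\<Sum>n<M. N n (v n))"
proof (induction M)
  case 0
  have "head 0 v = 0" by (simp add: head_def fun_eq_iff)
  then have "nr (head 0 v) = 0" by (simp only: nr_zero)
  then show ?case by simp
next
  case (Suc M)
  let ?e = "\<lambda>n. if n = M then v M else 0"
  have "(\<lambda>n. N n (?e n)) = (\<lambda>n. if n = M then N M (v M) else 0)"
    by (auto simp: E.nr_zero)
  then have "nr ?e = N M (v M)"
    using E.nr_nonneg[OF assms] by (simp add: nr_def nn_single)
  moreover have "?e \<in> X"
    using assms by (intro finite_support_mem) (auto simp: E.zero_mem)
  moreover have "head (Suc M) v = head M v + ?e"
    by (auto simp: head_def fun_eq_iff)
  ultimately have "nr (head (Suc M) v) \<le> nr (head M v) + N M (v M)"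
    using nr_triangle[OF head_mem[OF assms]] by metis
  with Suc show ?case by simp
qed

lemma nr_split: "v \<in> X \<Longrightarrow> nr v = f (nr (head M v)) (nr (tail M v))"
  unfolding nr_def norm_head norm_tail by (rule nn_split[OF X_D X_nonneg])

lemma nr_head_tail:
  assumes "u \<in> X" "w \<in> X"
  shows "nr (head M u + tail M w) = f (nr (head M u)) (nr (tail M w))"
proof -
  have z: "head M u + tail M w \<in> X"
    using assms by (intro add_mem head_mem tail_mem X_V)
  have "head M (head M u + tail M w) = head M u" "tail M (head M u + tail M w) = tail M w"
    by (auto simp: head_def tail_def fun_eq_iff)
  then show ?thesis
    using nr_split[OF z, of M] by (simp only:)
qed

lemma nr_head_tendsto:
  assumes "\<And>k n. w k n \<in> V n" "\<And>n. (\<lambda>k. N n (w k n)) \<longlonglongrightarrow> 0"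
  shows "(\<lambda>k. nr (head M (w k))) \<longlonglongrightarrow> 0"
proof (rule real_tendsto_sandwich[OF _ _ tendsto_const])
  show "\<forall>\<^sub>F k in sequentially. 0 \<le> nr (head M (w k))"
    using assms by (intro always_eventually allI nr_nonneg head_mem)
  show "\<forall>\<^sub>F k in sequentially. nr (head M (w k)) \<le> (\<Sum>n<M. N n (w k n))"
    using assms by (intro always_eventually allI nr_head_le_sum)
  show "(\<lambda>k. \<Sum>n<M. N n (w k n)) \<longlonglongrightarrow> 0"
    using tendsto_sum[of "{..<M}" "\<lambda>n k. N n (w k n)" "\<lambda>_. 0"] assms(2) by simp
qed

text \<open>A form of the Brezis-Lieb lemma.\<close>

lemma nr_add_coord_null:
  assumes v: "v \<in> X" and w: "\<And>k. w k \<in> X" and null: "\<And>n. (\<lambda>k. N n (w k n)) \<longlonglongrightarrow> 0"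
  shows "(\<lambda>k. nr (v + w k) - f (nr v) (nr (w k))) \<longlonglongrightarrow> 0"
proof (rule LIMSEQ_I)
  fix e :: real assume e: "0 < e"
  \<comment> \<open>The norms of \<open>tail M v\<close> and \<open>head M (w k)\<close> each enter
    the final estimate twice, hence a quarter of \<open>e\<close> for each.\<close>
  then have e4: "0 < e / 4" by simp
  obtain M where M: "nr (tail M v) < e / 4"
    using eventually_happens'[OF sequentially_bot order_tendstoD(2)[OF nr_tail_tendsto[OF v] e4]]
    by blast
  obtain K where K: "\<And>k. k \<ge> K \<Longrightarrow> nr (head M (w k)) < e / 4"
    using order_tendstoD(2)[OF nr_head_tendsto[OF X_V[OF w] null, of M] e4]
    unfolding eventually_sequentially by blast
  have "norm (nr (v + w k) - f (nr v) (nr (w k)) - 0) < e" if "k \<ge> K" for k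
  proof -
    \<comment> \<open>The comparison vector is \<open>head M v + tail M (w k)\<close>: its norm is
      exactly \<open>f\<close> of the norms of its two blocks, and it differs from
      \<open>v + w k\<close> by two small blocks only.\<close>
    have hv: "head M v \<in> X" and tv: "tail M v \<in> X" and hw: "head M (w k) \<in> X" and tw: "tail M (w k) \<in> X"
      using v w by (auto intro: head_mem tail_mem X_V)
    note dec = head_plus_tail[of M v] head_plus_tail[of M "w k"]
    have "v + w k - (head M v + tail M (w k)) =
        (head M v + tail M v) + (head M (w k) + tail M (w k)) - (head M v + tail M (w k))"
      by (simp only: dec)
    also have "\<dots> = tail M v + head M (w k)" by (simp add: algebra_simps)
    finally have "nr (v + w k - (head M v + tail M (w k))) \<le> nr (tail M v) + nr (head M (w k))"
      using nr_triangle[OF tv hw] by simp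
    then have 1: "\<bar>nr (v + w k) - nr (head M v + tail M (w k))\<bar> \<le> nr (tail M v) + nr (head M (w k))"
      using nr_reverse_triangle[OF add_mem[OF v w] add_mem[OF hv tw]] by (rule order_trans[rotated])
    have "v - head M v = tail M v" "w k - tail M (w k) = head M (w k)"
      using dec by (simp_all add: diff_eq_eq add.commute)
    then have 2: "\<bar>nr v - nr (head M v)\<bar> \<le> nr (tail M v)"
      "\<bar>nr (w k) - nr (tail M (w k))\<bar> \<le> nr (head M (w k))"
      using nr_reverse_triangle[OF v hv] nr_reverse_triangle[OF w tw, of k] by simp_all
    have 3: "\<bar>nr (head M v + tail M (w k)) - f (nr v) (nr (w k))\<bar>
        \<le> \<bar>nr v - nr (head M v)\<bar> + \<bar>nr (w k) - nr (tail M (w k))\<bar>"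
      unfolding nr_head_tail[OF v w]
      using f_lipschitz[OF nr_nonneg[OF v] nr_nonneg[OF w] nr_nonneg[OF hv] nr_nonneg[OF tw]]
      by (simp add: abs_minus_commute)
    have "\<bar>nr (v + w k) - f (nr v) (nr (w k))\<bar> < e"
      using 1 2 3 M K[OF that] by linarith
    then show ?thesis by simp
  qed
  then show "\<exists>K. \<forall>k\<ge>K. norm (nr (v + w k) - f (nr v) (nr (w k)) - 0) < e" by blast
qed

text \<open>Each coordinate is a bounded sequence in a finite-dimensional space, so a diagonal
  argument makes all coordinates converge along one subsequence. Nothing is claimed about
  \<open>y\<close> lying in \<open>X\<close>.\<close>

lemma coord_convergent_subseq:
  assumes u: "\<And>k. u k \<in> X" "\<And>k. nr (u k) \<le> C"
  obtains r y where "strict_mono (r :: nat \<Rightarrow> nat)" "\<And>n. y n \<in> V n"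
    "\<And>n. (\<lambda>k. N n (u (r k) n - y n)) \<longlonglongrightarrow> 0"
proof -
  define P where "P n s \<longleftrightarrow> (\<exists>y\<in>V n. (\<lambda>k. N n (u (s k) n - y)) \<longlonglongrightarrow> 0)" for n and s :: "nat \<Rightarrow> nat"
  interpret S: subseqs P
  proof
    fix n and s :: "nat \<Rightarrow> nat"
    obtain B where B: "finite B" "span B = V n"
      using fin_dim[of n] by (auto simp: finite_dim_banach_on_def)
    have "N n (u (s k) n) \<le> C" for k
      using coord_le[OF u(1)] u(2) by (rule order_trans)
    moreover have "u (s k) n \<in> span B" for k using X_V[OF u(1)] B by simp
    ultimately obtain r y where "strict_mono r" "y \<in> span B"
      "(\<lambda>k. N n (u (s (r k)) n - y)) \<longlonglongrightarrow> 0"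
      using E.bounded_subseq_in_span[of B n "\<lambda>k. u (s k) n" C] B span_superset[of B] by metis
    then show "\<exists>r'. strict_mono r' \<and> P n (s \<circ> r')"
      using B by (auto simp: P_def)
  qed
  have "\<exists>y\<in>V n. (\<lambda>k. N n (u (S.diagseq k) n - y)) \<longlonglongrightarrow> 0" for n
  proof -
    \<comment> \<open>Only from index \<open>Suc n\<close> on is the diagonal sequence a subsequence
      of the one chosen for coordinate \<open>n\<close>; the offset does not affect the
      limit.\<close>
    have "P n (S.diagseq \<circ> (+) (Suc n))"
    proof (rule S.diagseq_holds)
      fix r s :: "nat \<Rightarrow> nat" and n assume "strict_mono r" "P n s"
      then show "P n (s \<circ> r)"
        unfolding P_def using LIMSEQ_subseq_LIMSEQ[of "\<lambda>k. N n (u (s k) n - _)" 0 r]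
        by (auto simp: o_def)
    qed
    then obtain y where y: "y \<in> V n" "(\<lambda>k. N n (u (S.diagseq (k + Suc n)) n - y)) \<longlonglongrightarrow> 0"
      unfolding P_def by (auto simp: add.commute)
    from LIMSEQ_offset[OF this(2)] y(1) show ?thesis by (rule bexI)
  qed
  then obtain y where "\<And>n. y n \<in> V n" "\<And>n. (\<lambda>k. N n (u (S.diagseq k) n - y n)) \<longlonglongrightarrow> 0"
    by metis
  with S.subseq_diagseq show thesis by (rule that)
qed

end

subsection \<open>Coordinatewise null subsequences of the basis\<close>

lemma strict_mono_eventually_notin:
  assumes "strict_mono (r :: nat \<Rightarrow> nat)" "finite F"
  shows "eventually (\<lambda>k. r k \<notin> F) sequentially"
proof (rule eventually_mono[OF eventually_gt_at_top[of "Max (insert 0 F)"]])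
  fix k assume k: "Max (insert 0 F) < k"
  show "r k \<notin> F"
  proof
    assume "r k \<in> F"
    then have "r k \<le> Max (insert 0 F)" using assms(2) by (intro Max_ge) auto
    with k seq_suble[OF assms(1), of k] show False by linarith
  qed
qed

lemma sum_fun_apply: "(\<Sum>i\<in>A. g i) n = (\<Sum>i\<in>A. (g i :: 'b \<Rightarrow> 'c::comm_monoid_add) n)"
  by (induction A rule: infinite_finite_induct) simp_all

locale greedy_sum = fin_dim_sum D nn f V N
  for D nn f and V :: "nat \<Rightarrow> 'a::real_vector set" and N +
  fixes x :: "nat \<Rightarrow> nat \<Rightarrow> 'a"
  assumes greedy_X: "greedy_basis_on 1 X nr x"
    and unit_X: "\<And>i. nr (x i) = 1"
begin

sublocale one_greedy X nr x
  using greedy_X unit_X by unfold_locales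

lemma nr_scale_x: "nr (t *\<^sub>R x i) = \<bar>t\<bar>"
  by (simp add: nr_scale x_mem unit)

text \<open>By \<open>swap\<close>, replacing \<open>x j\<close> by \<open>x (r k)\<close> with
  \<open>r k\<close> outside \<open>S\<close> does not change the left side. It therefore equals its
  own limit along \<open>r\<close>, which \<open>nr_add_coord_null\<close> evaluates.\<close>

lemma add_largest:
  assumes r: "strict_mono r" and null: "\<And>n. (\<lambda>k. N n (x (r k) n)) \<longlonglongrightarrow> 0"
    and S: "finite S" "j \<notin> S" "\<And>i. i \<in> S \<Longrightarrow> \<bar>a i\<bar> \<le> \<bar>t\<bar>"
  shows "nr ((\<Sum>i\<in>S. a i *\<^sub>R x i) + t *\<^sub>R x j) = f (nr (\<Sum>i\<in>S. a i *\<^sub>R x i)) \<bar>t\<bar>"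
proof -
  let ?v = "\<Sum>i\<in>S. a i *\<^sub>R x i"
  have "(\<lambda>k. N n ((t *\<^sub>R x (r k)) n)) \<longlonglongrightarrow> 0" for n
    using tendsto_mult_right_zero[OF null[of n], of "\<bar>t\<bar>"] by (simp add: E.nr_scale X_V x_mem)
  from nr_add_coord_null[OF comb_mem scale_mem[OF x_mem] this, of a S]
  have "(\<lambda>k. nr (?v + t *\<^sub>R x (r k)) - f (nr ?v) \<bar>t\<bar>) \<longlonglongrightarrow> 0"
    by (simp only: nr_scale_x)
  moreover have "\<forall>\<^sub>F k in sequentially.
      nr (?v + t *\<^sub>R x (r k)) - f (nr ?v) \<bar>t\<bar> = nr (?v + t *\<^sub>R x j) - f (nr ?v) \<bar>t\<bar>"
    using strict_mono_eventually_notin[OF r S(1)]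
  proof eventually_elim
    case (elim k)
    have "nr (?v + t *\<^sub>R x (r k)) = nr (?v + t *\<^sub>R x j)"
      using S elim by (intro swap) auto
    then show ?case by (rule arg_cong)
  qed
  ultimately have "(\<lambda>k::nat. nr (?v + t *\<^sub>R x j) - f (nr ?v) \<bar>t\<bar>) \<longlonglongrightarrow> 0"
    by (rule Lim_transform_eventually)
  then show ?thesis by (simp add: LIMSEQ_const_iff)
qed

text \<open>The situation of \<open>p < \<infinity>\<close>: \<open>bounded_D\<close> puts the
  coordinatewise limit \<open>y\<close> into \<open>X\<close>, and \<open>inj\<close> permits
  cancelling \<open>f _ s\<close> in an equality of limits. This is done twice, first for fixed
  \<open>l\<close> and then as \<open>l\<close> grows, to obtain \<open>y = 0\<close>.\<close>

lemma coord_null_subseq_if_injective: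
  assumes inj: "\<And>a b s. 0 \<le> a \<Longrightarrow> 0 \<le> b \<Longrightarrow> 0 \<le> s \<Longrightarrow> f a s = f b s \<Longrightarrow> a = b"
    and bounded_D: "\<And>g C. (\<And>n. 0 \<le> g n) \<Longrightarrow> (\<And>M. nn (head M g) \<le> C) \<Longrightarrow> g \<in> D"
  obtains r where "strict_mono r" "\<And>n. (\<lambda>k. N n (x (r k) n)) \<longlonglongrightarrow> 0"
proof -
  obtain r1 y where r1: "strict_mono (r1 :: nat \<Rightarrow> nat)" and y: "\<And>n. y n \<in> V n"
    and conv1: "\<And>n. (\<lambda>k. N n (x (r1 k) n - y n)) \<longlonglongrightarrow> 0"
    by (rule coord_convergent_subseq[of x, OF x_mem eq_refl[OF unit]]) (rule that)
  \<comment> \<open>A Fatou-type bound: on the first \<open>M\<close> coordinates, \<open>y\<close>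
    is the norm limit of vectors of norm at most \<open>1\<close>.\<close>
  have "nr (head M y) \<le> 1" for M
  proof -
    let ?w = "\<lambda>k n. x (r1 k) n - y n"
    have wV: "?w k n \<in> V n" for k n by (intro E.diff_mem X_V[OF x_mem] y)
    have "nr (head M y) \<le> 1 + nr (head M (?w k))" for k
    proof -
      have "head M y = head M (x (r1 k)) - head M (?w k)"
        by (auto simp: head_def fun_eq_iff)
      moreover have "nr (head M (x (r1 k))) \<le> 1"
        using nr_head_le[OF x_mem, of M "r1 k"] unit[of "r1 k"] by simp
      ultimately show ?thesis
        using nr_diff_triangle[OF head_mem head_mem, of "x (r1 k)" "?w k" M M] wV X_V[OF x_mem]
        by simp
    qed
    moreover have "(\<lambda>k. 1 + nr (head M (?w k))) \<longlonglongrightarrow> 1 + 0"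
      by (intro tendsto_add tendsto_const nr_head_tendsto wV conv1)
    ultimately have "nr (head M y) \<le> 1 + 0"
      by (intro LIMSEQ_le_const[of "\<lambda>k. 1 + nr (head M (?w k))" "1 + 0"]) auto
    then show ?thesis by simp
  qed
  then have "(\<lambda>n. N n (y n)) \<in> D"
    by (intro bounded_D[of _ 1]) (auto simp: nr_def norm_head E.nr_nonneg y)
  then have yX: "y \<in> X" by (simp add: X_def y)
  \<comment> \<open>The distances from \<open>y\<close> are bounded, so a second subsequence makes
    them converge to some \<open>s0\<close>.\<close>
  have "nr (x (r1 k) - y) \<le> 1 + nr y" for k
    using nr_diff_triangle[OF x_mem yX, of "r1 k"] unit by simp
  then have "bounded (range (\<lambda>k. nr (x (r1 k) - y)))"
    using nr_nonneg[OF diff_mem[OF x_mem yX]] by (auto simp: bounded_iff)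
  then obtain s0 r2 where r2: "strict_mono r2" and s1: "((\<lambda>k. nr (x (r1 k) - y)) \<circ> r2) \<longlonglongrightarrow> s0"
    using bounded_imp_convergent_subsequence by blast
  define r where "r = r1 \<circ> r2"
  define u where "u k = x (r k) - y" for k
  have r: "strict_mono r" unfolding r_def using r1 r2 by (rule strict_mono_o)
  have uX: "u k \<in> X" for k unfolding u_def by (intro diff_mem x_mem yX)
  have u_null: "(\<lambda>k. N n (u k n)) \<longlonglongrightarrow> 0" for n
    using LIMSEQ_subseq_LIMSEQ[OF conv1[of n] r2] by (simp add: u_def r_def o_def)
  have s: "(\<lambda>k. nr (u k)) \<longlonglongrightarrow> s0"
    using s1 by (simp add: u_def r_def o_def)
  have s0: "0 \<le> s0"
    by (rule LIMSEQ_le_const[OF s]) (auto intro: nr_nonneg uX)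
  have lim: "(\<lambda>k. nr (v + u k)) \<longlonglongrightarrow> f (nr v) s0" if "v \<in> X" for v
    using tendsto_add[OF nr_add_coord_null[OF that uX u_null]
        f_tendsto_right[OF s nr_nonneg[OF uX] nr_nonneg[OF that]]] by simp
  have sym: "nr (x (r l) + y) = nr (u l)" for l
  proof -
    \<comment> \<open>Adding \<open>u k\<close> to \<open>?p\<close> and \<open>?m\<close> cancels
      \<open>y\<close> and leaves \<open>x (r l) + x (r k)\<close> and
      \<open>x (r k) - x (r l)\<close>, whose norms agree by \<open>swap\<close>. Letting
      \<open>k\<close> grow and cancelling \<open>s0\<close> compares \<open>?p\<close> with
      \<open>?m\<close>.\<close>
    let ?p = "x (r l) + y" and ?m = "y - x (r l)"
    have p: "?p \<in> X" and m: "?m \<in> X" by (intro add_mem diff_mem x_mem yX)+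
    have "\<forall>\<^sub>F k in sequentially. nr (?p + u k) = nr (?m + u k)"
      using strict_mono_eventually_notin[OF r, of "{r l}", simplified]
    proof eventually_elim
      case (elim k)
      have "nr (x (r l) + x (r k)) = nr (x (r l) - x (r k))"
        using swap[of "{r l}" "r k" "r k" "\<lambda>_. 1" 1 "-1"] elim by simp
      then show ?case
        using nr_diff_commute[OF x_mem x_mem, of "r l" "r k"] by (simp add: u_def algebra_simps)
    qed
    with lim[OF p] have "(\<lambda>k. nr (?m + u k)) \<longlonglongrightarrow> f (nr ?p) s0"
      by (rule Lim_transform_eventually)
    then have "f (nr ?p) s0 = f (nr ?m) s0"
      using lim[OF m] by (rule LIMSEQ_unique)
    then have "nr ?p = nr ?m"
      by (rule inj[OF nr_nonneg[OF p] nr_nonneg[OF m] s0])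
    then show ?thesis using nr_diff_commute[OF x_mem yX, of "r l"] by (simp add: u_def)
  qed
  \<comment> \<open>Since \<open>y + y + u l = x (r l) + y\<close>, the symmetry just shown says
    that adding \<open>2y\<close> does not change the norm of \<open>u l\<close>; now
    \<open>l\<close> tends to infinity.\<close>
  have "nr (y + y + u l) = nr (u l)" for l
    using sym[of l] by (simp add: u_def algebra_simps)
  then have "(\<lambda>l. nr (u l)) \<longlonglongrightarrow> f (nr (y + y)) s0"
    using lim[OF add_mem[OF yX yX]] by (simp only:)
  with s have "s0 = f (nr (y + y)) s0"
    by (rule LIMSEQ_unique)
  then have "f 0 s0 = f (nr (y + y)) s0"
    by (simp only: f_0_left[OF s0])
  then have "0 = nr (y + y)"
    by (rule inj[OF order_refl nr_nonneg[OF add_mem[OF yX yX]] s0])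
  then have "y + y = 0" by (simp only: nr_eq_0[OF add_mem[OF yX yX], symmetric])
  then have "2 *\<^sub>R y = 0" by (simp add: scaleR_2)
  then have "y = 0" by simp
  then have "\<And>n. (\<lambda>k. N n (x (r k) n)) \<longlonglongrightarrow> 0"
    using u_null by (simp add: u_def)
  with r show thesis by (rule that)
qed

lemma coord_null_subseq_if_max:
  assumes f_max: "f = max"
  obtains r where "strict_mono r" "\<And>n. (\<lambda>k. N n (x (r k) n)) \<longlonglongrightarrow> 0"
proof -
  obtain r y where r: "strict_mono (r :: nat \<Rightarrow> nat)" and y: "\<And>n. y n \<in> V n"
    and conv: "\<And>n. (\<lambda>k. N n (x (r k) n - y n)) \<longlonglongrightarrow> 0"
    by (rule coord_convergent_subseq[of x, OF x_mem eq_refl[OF unit]]) (rule that)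
  \<comment> \<open>Differences of consecutive terms are coordinatewise null and lie in
    \<open>X\<close>, whereas \<open>x (r k) - y\<close> need not lie in \<open>X\<close>.\<close>
  define d where "d k = x (r k) - x (r (Suc k))" for k
  have dX: "d k \<in> X" for k unfolding d_def by (intro diff_mem x_mem)
  have xV: "x i n \<in> V n" for i n by (rule X_V[OF x_mem])
  have d_null: "(\<lambda>k. N n (d k n)) \<longlonglongrightarrow> 0" for n
  proof (rule null_dominated)
    show "0 \<le> N n (d k n)" for k by (rule X_nonneg[OF dX])
    show "N n (d k n) \<le> N n (x (r k) n - y n) + N n (x (r (Suc k)) n - y n)" for k
      using E.nr_diff_triangle[OF E.diff_mem[OF xV[of "r k" n] y] E.diff_mem[OF xV[of "r (Suc k)" n] y]]
      by (simp add: d_def)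
    show "(\<lambda>k. N n (x (r k) n - y n) + N n (x (r (Suc k)) n - y n)) \<longlonglongrightarrow> 0"
      using tendsto_add[OF conv[of n] LIMSEQ_Suc[OF conv[of n]]] by simp
  qed
  have d2: "nr (d k) \<le> 2" for k
    using nr_diff_triangle[OF x_mem x_mem, of "r k" "r (Suc k)"] unit by (simp add: d_def)
  \<comment> \<open>Induction step: two members of \<open>F\<close> are exchanged for the two terms
    of \<open>d k\<close> without changing the norm. As \<open>k\<close> grows, this norm approaches
    the maximum of the norms of the remaining sum and of \<open>d k\<close>, both at most
    \<open>2\<close>.\<close>
  have bound: "nr (\<Sum>i\<in>F. x i) \<le> 2" if "finite F" "card F = 2 * m" for F m
    using that
  proof (induction m arbitrary: F)
    case 0
    then have "F = {}" by simp
    then show ?case by (simp only: sum.empty nr_zero)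
  next
    case (Suc m)
    then obtain i where i: "i \<in> F" by fastforce
    with Suc.prems have "card (F - {i}) = Suc (2 * m)" by simp
    then have "F - {i} \<noteq> {}" by (metis card.empty Zero_not_Suc)
    then obtain j where j: "j \<in> F - {i}" by blast
    define G where "G = F - {i, j}"
    have G: "finite G" "i \<notin> G" "j \<notin> G" "i \<noteq> j" and F: "F = insert i (insert j G)"
      using Suc.prems(1) i j by (auto simp: G_def)
    have "card G = 2 * m" using Suc.prems(2) G unfolding F by simp
    with Suc.IH G(1) have v2: "nr (\<Sum>i\<in>G. x i) \<le> 2" by blast
    let ?v = "\<Sum>i\<in>G. x i"
    have vX: "?v \<in> X" by (intro sum_mem x_mem)
    have ev: "\<forall>\<^sub>F k in sequentially. r k \<notin> insert i G"
      using r G(1) by (simp add: strict_mono_eventually_notin del: insert_iff)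
    then have "\<forall>\<^sub>F k in sequentially. r (Suc k) \<notin> insert i G"
      by (rule eventually_sequentially_Suc[of "\<lambda>k. r k \<notin> insert i G", THEN iffD2])
    with ev have "\<forall>\<^sub>F k in sequentially. nr (?v + d k) - f (nr ?v) (nr (d k)) \<ge> nr (\<Sum>i\<in>F. x i) - 2"
    proof eventually_elim
      case (elim k)
      \<comment> \<open>First \<open>x j\<close> is swapped for \<open>- x ?l\<close>, then
        \<open>x i\<close> for \<open>x (r k)\<close>; \<open>?a\<close> records the coefficient
        \<open>-1\<close> at \<open>?l\<close> during the second swap.\<close>
      let ?l = "r (Suc k)" let ?a = "\<lambda>l. if l = ?l then -1 else (1::real)"
      have kl: "r k \<noteq> ?l" using r by (simp add: strict_mono_eq)
      have notin: "r k \<notin> insert i G" "?l \<notin> insert i G" using elim G(1) by auto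
      have sumG: "(\<Sum>l\<in>G. ?a l *\<^sub>R x l) = ?v" using notin by (intro sum.cong) auto
      have "nr (\<Sum>i\<in>F. x i) = nr ((\<Sum>l\<in>insert i G. 1 *\<^sub>R x l) + 1 *\<^sub>R x j)"
        unfolding F using G by (simp add: algebra_simps)
      also have "\<dots> = nr ((\<Sum>l\<in>insert i G. 1 *\<^sub>R x l) + (-1) *\<^sub>R x ?l)"
        using G notin by (intro swap) auto
      also have "(\<Sum>l\<in>insert i G. 1 *\<^sub>R x l) + (-1) *\<^sub>R x ?l =
          (\<Sum>l\<in>insert ?l G. ?a l *\<^sub>R x l) + 1 *\<^sub>R x i"
        using G notin sumG by (simp add: algebra_simps)
      also have "nr \<dots> = nr ((\<Sum>l\<in>insert ?l G. ?a l *\<^sub>R x l) + 1 *\<^sub>R x (r k))"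
        using G notin kl by (intro swap) auto
      also have "(\<Sum>l\<in>insert ?l G. ?a l *\<^sub>R x l) + 1 *\<^sub>R x (r k) = ?v + d k"
        using G notin sumG by (simp add: d_def algebra_simps)
      finally have "nr (\<Sum>i\<in>F. x i) = nr (?v + d k)" .
      moreover have "f (nr ?v) (nr (d k)) \<le> 2" using v2 d2 by (simp add: f_max)
      ultimately show ?case by simp
    qed
    with nr_add_coord_null[OF vX dX d_null] have "nr (\<Sum>i\<in>F. x i) - 2 \<le> 0"
      by (rule tendsto_lowerbound) simp
    then show ?case by simp
  qed
  have "N n (y n) = 0" for n
  proof (rule ccontr)
    let ?c = "N n (y n)"
    assume "?c \<noteq> 0"
    then have c: "?c > 0" using E.nr_nonneg[OF y, of n] by simp
    \<comment> \<open>Beyond \<open>K\<close> every \<open>x (r k) n\<close> is within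
      \<open>?c / 2\<close> of \<open>y n\<close>, so coordinate \<open>n\<close> of a sum of
      \<open>2 * m\<close> of them has norm at least \<open>m * ?c\<close>. This \<open>m\<close>
      makes that exceed the bound \<open>2\<close>.\<close>
    obtain m :: nat where m: "2 < real m * ?c" using c reals_Archimedean3 by blast
    obtain K where K: "\<And>k. k \<ge> K \<Longrightarrow> N n (x (r k) n - y n) < ?c / 2"
      using LIMSEQ_D[OF conv[of n], of "?c / 2"] c by fastforce
    let ?I = "{K..<K + 2 * m}"
    have inj: "inj_on r ?I" using r by (simp add: strict_mono_imp_inj_on inj_on_subset[of r UNIV])
    let ?s = "\<Sum>i\<in>r ` ?I. x i"
    have sX: "?s \<in> X" by (intro sum_mem x_mem)
    have "?s n = (\<Sum>k\<in>?I. x (r k) n)"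
      by (simp add: sum.reindex[OF inj] sum_fun_apply)
    also have "\<dots> = (\<Sum>k\<in>?I. x (r k) n - y n) + (2 * real m) *\<^sub>R y n"
      by (simp add: sum_subtractf sum_constant_scaleR)
    finally have eq: "(2 * real m) *\<^sub>R y n = ?s n - (\<Sum>k\<in>?I. x (r k) n - y n)" by simp
    have eV: "(\<Sum>k\<in>?I. x (r k) n - y n) \<in> V n"
      by (intro E.sum_mem E.diff_mem xV y)
    have "2 * real m * ?c = N n ((2 * real m) *\<^sub>R y n)"
      by (simp add: E.nr_scale y)
    also have "\<dots> \<le> N n (?s n) + N n (\<Sum>k\<in>?I. x (r k) n - y n)"
      unfolding eq by (rule E.nr_diff_triangle[OF X_V[OF sX] eV])
    also have "N n (?s n) \<le> 2"
      using coord_le[OF sX, of n] bound[of "r ` ?I" m] inj by (simp add: card_image)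
    also have "N n (\<Sum>k\<in>?I. x (r k) n - y n) \<le> (\<Sum>k\<in>?I. N n (x (r k) n - y n))"
      by (intro E.nr_sum_le E.diff_mem xV y)
    also have "\<dots> \<le> (\<Sum>k\<in>?I. ?c / 2)"
      using K by (intro sum_mono less_imp_le) auto
    finally have "2 * real m * ?c \<le> 2 + real m * ?c" by simp
    with m show False by simp
  qed
  then have "y n = 0" for n using E.nr_eq_0[OF y] by simp
  then have "\<And>n. (\<lambda>k. N n (x (r k) n)) \<longlonglongrightarrow> 0"
    using conv by simp
  with r show thesis by (rule that)
qed

end

subsection \<open>The spaces \<open>c\<^sub>0\<close> and \<open>\<ell>\<^sub>p\<close>\<close>

definition c0 :: "(nat \<Rightarrow> real) set" where
  "c0 = {g. g \<longlonglongrightarrow> 0}"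

definition sup_norm :: "(nat \<Rightarrow> real) \<Rightarrow> real" where
  "sup_norm g = (SUP n. g n)"

lemma c0_bdd_above: "g \<in> c0 \<Longrightarrow> bdd_above (range g)"
  unfolding c0_def using convergent_imp_bounded[of g 0] by (simp add: bounded_imp_bdd_above)

lemma sup_norm_upper: "g \<in> c0 \<Longrightarrow> g n \<le> sup_norm g"
  unfolding sup_norm_def by (rule cSUP_upper[OF UNIV_I c0_bdd_above])

lemma sup_norm_least: "(\<And>n. g n \<le> C) \<Longrightarrow> sup_norm g \<le> C"
  unfolding sup_norm_def by (rule cSUP_least) auto

lemma seq_norm_c0: "seq_norm c0 sup_norm max"
proof
  fix g :: "nat \<Rightarrow> real"
  assume "finite {n. g n \<noteq> 0}"
  then have "\<forall>\<^sub>F n in sequentially. g n = 0"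
    by (simp add: eventually_cofinite flip: cofinite_eq_sequentially)
  then show "g \<in> c0" by (simp add: c0_def tendsto_eventually)
next
  fix g h :: "nat \<Rightarrow> real"
  assume "g \<in> c0" "\<And>n. 0 \<le> h n" "\<And>n. h n \<le> g n"
  then show "h \<in> c0" unfolding c0_def using null_dominated[of h g] by simp
next
  fix g h :: "nat \<Rightarrow> real"
  assume "g \<in> c0" "\<And>n. h n \<le> g n"
  then show "sup_norm h \<le> sup_norm g"
    by (meson order_trans sup_norm_least sup_norm_upper)
next
  fix g h :: "nat \<Rightarrow> real"
  assume gh: "g \<in> c0" "h \<in> c0"
  then show "g + h \<in> c0"
    using tendsto_add[of g 0 sequentially h 0] by (simp add: c0_def plus_fun_def)
  show "sup_norm (g + h) \<le> sup_norm g + sup_norm h"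
    using gh by (intro sup_norm_least) (simp add: add_mono sup_norm_upper)
next
  fix g :: "nat \<Rightarrow> real" and c :: real
  assume g: "g \<in> c0" "\<And>n. 0 \<le> g n" and c: "0 \<le> c"
  show cg: "c *\<^sub>R g \<in> c0"
    using tendsto_mult_right_zero[of g sequentially c] g(1) by (simp add: c0_def scaleR_fun_def)
  show "sup_norm (c *\<^sub>R g) = c * sup_norm g"
  proof (rule antisym)
    show "sup_norm (c *\<^sub>R g) \<le> c * sup_norm g"
      using g(1) c by (intro sup_norm_least) (simp add: mult_left_mono sup_norm_upper)
    show "c * sup_norm g \<le> sup_norm (c *\<^sub>R g)"
    proof (cases "c = 0")
      case True
      then show ?thesis using sup_norm_upper[OF cg, of 0] by simp
    next
      case False
      then have "sup_norm g \<le> sup_norm (c *\<^sub>R g) / c"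
        using c sup_norm_upper[OF cg] by (intro sup_norm_least) (simp add: field_simps)
      then show ?thesis using c False by (simp add: field_simps)
    qed
  qed
next
  fix c :: real and m :: nat
  assume "0 \<le> c"
  then show "sup_norm (\<lambda>n. if n = m then c else 0) = c"
    unfolding sup_norm_def by (intro cSup_eq_maximum) auto
next
  fix g :: "nat \<Rightarrow> real"
  assume g: "g \<in> c0" "\<And>n. 0 \<le> g n"
  have le: "0 \<le> head M g n" "head M g n \<le> g n" "0 \<le> tail M g n" "tail M g n \<le> g n" for M n
    using g(2) by (auto simp: head_def tail_def)
  have mem: "head M g \<in> c0" "tail M g \<in> c0" for M
    using g(1) null_dominated[OF le(1,2)] null_dominated[OF le(3,4)] by (auto simp: c0_def)
  show "(\<lambda>M. sup_norm (tail M g)) \<longlonglongrightarrow> 0"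
  proof (rule LIMSEQ_I)
    fix e :: real assume e: "0 < e"
    then obtain K where K: "\<And>n. n \<ge> K \<Longrightarrow> g n < e / 2"
      using order_tendstoD(2)[of g 0 sequentially "e / 2"] g(1)
      unfolding c0_def eventually_sequentially by auto
    have "norm (sup_norm (tail M g) - 0) < e" if "M \<ge> K" for M
    proof -
      have "sup_norm (tail M g) \<le> e / 2"
        using K that e by (intro sup_norm_least) (auto simp: tail_def intro!: less_imp_le)
      moreover have "0 \<le> sup_norm (tail M g)"
        using le(3) sup_norm_upper[OF mem(2)] by (rule order_trans)
      ultimately show ?thesis using e by simp
    qed
    then show "\<exists>K. \<forall>M\<ge>K. norm (sup_norm (tail M g) - 0) < e" by blast
  qed
  fix M
  show "sup_norm g = max (sup_norm (head M g)) (sup_norm (tail M g))"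
  proof (rule antisym)
    have "g n = head M g n \<or> g n = tail M g n" for n by (auto simp: head_def tail_def)
    then have "g n \<le> max (sup_norm (head M g)) (sup_norm (tail M g))" for n
      using sup_norm_upper[OF mem(1), of M n] sup_norm_upper[OF mem(2), of M n]
      by (metis max.coboundedI1 max.coboundedI2)
    then show "sup_norm g \<le> max (sup_norm (head M g)) (sup_norm (tail M g))"
      by (rule sup_norm_least)
    show "max (sup_norm (head M g)) (sup_norm (tail M g)) \<le> sup_norm g"
      using order_trans[OF le(2) sup_norm_upper[OF g(1)]]
        order_trans[OF le(4) sup_norm_upper[OF g(1)]]
      by (intro max.boundedI sup_norm_least)
  qed
qed

section \<open>The sequence norm of ell_p and Minkowski's inequality\<close>

definition lq :: "real \<Rightarrow> (nat \<Rightarrow> real) set" where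
  "lq q = {g. summable (\<lambda>n. g n powr q)}"

definition lq_norm :: "real \<Rightarrow> (nat \<Rightarrow> real) \<Rightarrow> real" where
  "lq_norm q g = (\<Sum>n. g n powr q) powr (1 / q)"

definition lq_pair :: "real \<Rightarrow> real \<Rightarrow> real \<Rightarrow> real" where
  "lq_pair q a b = (a powr q + b powr q) powr (1 / q)"

lemma powr_inverse_cancel:
  fixes a q :: real
  assumes "0 \<le> a" "q \<noteq> 0"
  shows "(a powr (1 / q)) powr q = a" "(a powr q) powr (1 / q) = a"
  using assms by (simp_all add: powr_powr)

text \<open>Convexity of the power function for positive arguments; when \<open>a\<close> or
  \<open>b\<close> vanishes, it reduces to \<open>w powr q \<le> w\<close> for weights
  \<open>w\<close> in \<open>(0, 1]\<close>.\<close>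

lemma powr_convex_comb_le:
  fixes a b u v q :: real
  assumes q: "1 \<le> q" and "0 \<le> a" "0 \<le> b" and uv: "0 < u" "0 < v" "u + v = 1"
  shows "(u * a + v * b) powr q \<le> u * a powr q + v * b powr q"
proof -
  have scale: "(w * c) powr q \<le> w * c powr q" if "0 < w" "w \<le> 1" "0 \<le> c" for w c :: real
  proof -
    have "w powr q \<le> w powr 1" using q that by (intro powr_mono') auto
    then show ?thesis using that by (simp add: powr_mult mult_right_mono)
  qed
  consider "a = 0" | "b = 0" | "a > 0" "b > 0" using assms by linarith
  then show ?thesis
  proof cases
    case 1
    then show ?thesis using scale[of v b] assms by simp
  next
    case 2
    then show ?thesis using scale[of u a] assms by simp
  next
    case 3
    have u: "u = 1 - v" using uv by simp
    show ?thesis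
      using convex_onD[OF powr_convex[OF q], of v a b] uv 3 unfolding u by simp
  qed
qed

text \<open>Convexity at \<open>a / A\<close> and \<open>b / B\<close> with weights
  \<open>A / (A + B)\<close> and \<open>B / (A + B)\<close>. This is the pointwise form of
  Minkowski's inequality when \<open>A\<close> and \<open>B\<close> bound the norms;
  \<open>A = B = 1\<close> gives summability of sums.\<close>

lemma powr_add_le:
  fixes a b A B q :: real
  assumes "1 \<le> q" "0 \<le> a" "0 \<le> b" "0 < A" "0 < B"
  shows "(a + b) powr q \<le> (A + B) powr q *
    (A / (A + B) * (a powr q / A powr q) + B / (A + B) * (b powr q / B powr q))"
proof -
  have "A / (A + B) * (a / A) = a / (A + B)" "B / (A + B) * (b / B) = b / (A + B)"
    using assms by simp_all
  then have "a + b = (A + B) * (A / (A + B) * (a / A) + B / (A + B) * (b / B))"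
    using assms by (simp add: add_divide_distrib[symmetric])
  then have "(a + b) powr q = (A + B) powr q * (A / (A + B) * (a / A) + B / (A + B) * (b / B)) powr q"
    using assms by (simp add: powr_mult)
  also have "\<dots> \<le> (A + B) powr q *
      (A / (A + B) * (a / A) powr q + B / (A + B) * (b / B) powr q)"
    using assms by (intro mult_left_mono powr_convex_comb_le) (auto simp: add_divide_distrib[symmetric])
  finally show ?thesis using assms by (simp add: powr_divide)
qed

lemma lq_norm_nonneg: "0 \<le> lq_norm q g"
  by (simp add: lq_norm_def)

lemma lq_norm_powr:
  assumes "0 < q" "g \<in> lq q"
  shows "lq_norm q g powr q = (\<Sum>n. g n powr q)"
  using assms unfolding lq_norm_def lq_def by (intro powr_inverse_cancel) (auto intro: suminf_nonneg)

lemma lq_norm_head: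
  assumes "0 < q"
  shows "head M g \<in> lq q" "lq_norm q (head M g) powr q = (\<Sum>n<M. g n powr q)"
proof -
  have "summable (\<lambda>n. head M g n powr q)"
    by (rule summable_finite[of "{..<M}"]) (auto simp: head_def)
  then show mem: "head M g \<in> lq q" by (simp add: lq_def)
  have "(\<Sum>n. head M g n powr q) = (\<Sum>n<M. head M g n powr q)"
    by (rule suminf_finite) (auto simp: head_def)
  also have "\<dots> = (\<Sum>n<M. g n powr q)" by (simp add: head_def)
  finally show "lq_norm q (head M g) powr q = (\<Sum>n<M. g n powr q)"
    using lq_norm_powr[OF assms mem] by simp
qed

lemma lq_norm_tail:
  assumes "0 < q" "g \<in> lq q"
  shows "tail M g \<in> lq q"
    "lq_norm q (tail M g) powr q = (\<Sum>n. g n powr q) - (\<Sum>n<M. g n powr q)"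
proof -
  have eq: "(\<lambda>n. tail M g n powr q) = (\<lambda>n. g n powr q - head M g n powr q)"
    by (auto simp: head_def tail_def)
  have sm: "summable (\<lambda>n. g n powr q)" "summable (\<lambda>n. head M g n powr q)"
    using assms lq_norm_head(1)[OF assms(1)] by (auto simp: lq_def)
  show mem: "tail M g \<in> lq q"
    unfolding lq_def by (simp add: eq summable_diff sm)
  show "lq_norm q (tail M g) powr q = (\<Sum>n. g n powr q) - (\<Sum>n<M. g n powr q)"
    using suminf_diff[OF sm] lq_norm_powr[OF assms(1) mem] lq_norm_powr[OF assms(1) lq_norm_head(1)]
      lq_norm_head(2)[OF assms(1), of M g] assms(1) by (simp add: eq)
qed

lemma lq_add_mem:
  assumes "1 \<le> q" "g \<in> lq q" "h \<in> lq q" "\<And>n. 0 \<le> g n" "\<And>n. 0 \<le> h n"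
  shows "g + h \<in> lq q"
proof -
  have "summable (\<lambda>n. (g n + h n) powr q)"
  proof (rule summable_comparison_test')
    show "summable (\<lambda>n. 2 powr q * (1 / 2 * g n powr q + 1 / 2 * h n powr q))"
      using assms(2,3) unfolding lq_def by (intro summable_mult summable_add) auto
    show "norm ((g n + h n) powr q) \<le> 2 powr q * (1 / 2 * g n powr q + 1 / 2 * h n powr q)" for n
      using powr_add_le[of q "g n" "h n" 1 1] assms by simp
  qed
  then show ?thesis by (simp add: lq_def)
qed

lemma lq_norm_add_le:
  assumes q: "1 \<le> q" and g: "g \<in> lq q" "\<And>n. 0 \<le> g n" and h: "h \<in> lq q" "\<And>n. 0 \<le> h n"
  shows "lq_norm q (g + h) \<le> lq_norm q g + lq_norm q h"
proof (rule field_le_epsilon)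
  fix e :: real assume e: "0 < e"
  \<comment> \<open>The extra \<open>e / 2\<close> keeps \<open>A\<close> and \<open>B\<close>
    positive even when a norm is \<open>0\<close>. Both normalized series then sum to at most
    \<open>1\<close>, so the convex combination does too.\<close>
  define A where "A = lq_norm q g + e / 2"
  define B where "B = lq_norm q h + e / 2"
  have AB: "0 < A" "0 < B"
    using e lq_norm_nonneg[of q g] lq_norm_nonneg[of q h] unfolding A_def B_def by linarith+
  have q0: "0 < q" using q by simp
  have sm: "summable (\<lambda>n. g n powr q)" "summable (\<lambda>n. h n powr q)" "summable (\<lambda>n. (g n + h n) powr q)"
    using g(1) h(1) lq_add_mem[OF q g(1) h(1) g(2) h(2)] by (auto simp: lq_def)
  have le1: "(\<Sum>n. g n powr q) / A powr q \<le> 1" "(\<Sum>n. h n powr q) / B powr q \<le> 1"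
    using powr_mono2[of q "lq_norm q g" A] powr_mono2[of q "lq_norm q h" B] q0 e AB
      lq_norm_nonneg[of q g] lq_norm_nonneg[of q h]
    by (auto simp: A_def B_def lq_norm_powr[OF q0 g(1)] lq_norm_powr[OF q0 h(1)])
  have sum1: "A / (A + B) + B / (A + B) = 1"
    using AB by (simp add: add_divide_distrib[symmetric])
  let ?rhs = "\<lambda>n. (A + B) powr q *
    (A / (A + B) * (g n powr q / A powr q) + B / (A + B) * (h n powr q / B powr q))"
  have "(\<Sum>n. (g n + h n) powr q) \<le> suminf ?rhs"
    using powr_add_le[OF q g(2) h(2) AB] sm
    by (intro suminf_le summable_mult summable_add summable_divide)
  also have "suminf ?rhs = (A + B) powr q *
      (A / (A + B) * ((\<Sum>n. g n powr q) / A powr q) + B / (A + B) * ((\<Sum>n. h n powr q) / B powr q))"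
    using sm by (intro sums_unique[symmetric] sums_mult sums_add sums_divide summable_sums)
  also have "\<dots> \<le> (A + B) powr q * (A / (A + B) * 1 + B / (A + B) * 1)"
    using le1 AB by (intro mult_left_mono add_mono) auto
  also have "\<dots> = (A + B) powr q" using sum1 by simp
  finally have "lq_norm q (g + h) \<le> ((A + B) powr q) powr (1 / q)"
    unfolding lq_norm_def using q0 by (intro powr_mono2) (auto intro!: suminf_nonneg sm)
  also have "\<dots> = A + B" using AB q0 by (intro powr_inverse_cancel) auto
  finally show "lq_norm q (g + h) \<le> lq_norm q g + lq_norm q h + e"
    by (simp add: A_def B_def)
qed

lemma seq_norm_lq:
  assumes q: "1 \<le> q"
  shows "seq_norm (lq q) (lq_norm q) (lq_pair q)"
proof
  have q0: "0 < q" using q by simp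
  fix g :: "nat \<Rightarrow> real"
  show "g \<in> lq q" if "finite {n. g n \<noteq> 0}"
    using summable_finite[OF that, of "\<lambda>n. g n powr q"] by (simp add: lq_def)
  have mono: "h \<in> lq q" "lq_norm q h \<le> lq_norm q g"
    if "g \<in> lq q" "\<And>n. 0 \<le> h n" "\<And>n. h n \<le> g n" for h
  proof -
    have le: "h n powr q \<le> g n powr q" for n using that q0 by (intro powr_mono2) auto
    have sm: "summable (\<lambda>n. g n powr q)" using that(1) by (simp add: lq_def)
    then have sm': "summable (\<lambda>n. h n powr q)"
      by (rule summable_comparison_test') (simp add: le)
    then show "h \<in> lq q" by (simp add: lq_def)
    show "lq_norm q h \<le> lq_norm q g"
      unfolding lq_norm_def using q0 suminf_le[OF le sm' sm] suminf_nonneg[OF sm']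
      by (intro powr_mono2) simp_all
  qed
  show "h \<in> lq q" "lq_norm q h \<le> lq_norm q g"
    if "g \<in> lq q" "\<And>n. 0 \<le> h n" "\<And>n. h n \<le> g n" for h
    by (fact mono[OF that])+
  show "g + h \<in> lq q" "lq_norm q (g + h) \<le> lq_norm q g + lq_norm q h"
    if "g \<in> lq q" "h \<in> lq q" "\<And>n. 0 \<le> g n" "\<And>n. 0 \<le> h n" for h
    by (fact lq_add_mem[OF q that], fact lq_norm_add_le[OF q that(1,3,2,4)])
  show "lq_norm q (\<lambda>n. if n = m then c else 0) = c" if "0 \<le> c" for c :: real and m
  proof -
    have "(\<Sum>n. (if n = m then c else 0) powr q) = (\<Sum>n\<in>{m}. (if n = m then c else 0) powr q)"
      by (rule suminf_finite) auto
    then have "lq_norm q (\<lambda>n. if n = m then c else 0) = (c powr q) powr (1 / q)"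
      unfolding lq_norm_def by simp
    also have "\<dots> = c" using that q0 by (intro powr_inverse_cancel) auto
    finally show ?thesis .
  qed
  assume g: "g \<in> lq q" and nonneg: "\<And>n. 0 \<le> g n"
  have sm: "summable (\<lambda>n. g n powr q)" using g by (simp add: lq_def)
  show "c *\<^sub>R g \<in> lq q" for c
    using summable_mult[OF sm, of "c powr q"] by (simp add: lq_def powr_mult)
  show "lq_norm q (c *\<^sub>R g) = c * lq_norm q g" if "0 \<le> c" for c
  proof -
    have "(\<Sum>n. (c *\<^sub>R g) n powr q) = c powr q * (\<Sum>n. g n powr q)"
      using suminf_mult[OF sm, of "c powr q"] by (simp add: powr_mult)
    then have "lq_norm q (c *\<^sub>R g) = (c powr q) powr (1 / q) * lq_norm q g"
      by (simp only: lq_norm_def powr_mult)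
    moreover have "(c powr q) powr (1 / q) = c"
      using that q0 by (intro powr_inverse_cancel) auto
    ultimately show ?thesis by simp
  qed
  have lim: "(\<lambda>M. lq_norm q (tail M g) powr q) \<longlonglongrightarrow> 0"
    unfolding lq_norm_tail(2)[OF q0 g]
    using tendsto_diff[OF tendsto_const summable_LIMSEQ[OF sm], of "\<Sum>n. g n powr q"] by simp
  have "(\<lambda>M. (lq_norm q (tail M g) powr q) powr (1 / q)) \<longlonglongrightarrow> 0"
    by (rule tendsto_zero_powrI[OF lim tendsto_const]) (simp_all add: q0)
  then show "(\<lambda>M. lq_norm q (tail M g)) \<longlonglongrightarrow> 0"
    by (simp only: powr_inverse_cancel(2)[OF lq_norm_nonneg less_imp_neq[OF q0, symmetric]])
  show "lq_norm q g = lq_pair q (lq_norm q (head M g)) (lq_norm q (tail M g))" for M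
    unfolding lq_pair_def lq_norm_head(2)[OF q0] lq_norm_tail(2)[OF q0 g]
    by (simp add: lq_norm_def)
qed

text \<open>Raising to the power \<open>q\<close> and cancelling \<open>s powr q\<close>. The
  analogue for \<open>max\<close> is false, which is why the two cases of \<open>p\<close> need
  different arguments.\<close>

lemma lq_pair_inject:
  assumes "0 < q" "0 \<le> a" "0 \<le> b" "lq_pair q a s = lq_pair q b s"
  shows "a = b"
proof -
  have q: "q \<noteq> 0" using assms(1) by simp
  have "(a powr q + s powr q) = lq_pair q a s powr q" "(b powr q + s powr q) = lq_pair q b s powr q"
    unfolding lq_pair_def by (rule powr_inverse_cancel(1)[symmetric, OF _ q], simp)+
  with assms(4) have "a powr q = b powr q" by simp
  then have "(a powr q) powr (1 / q) = (b powr q) powr (1 / q)" by (rule arg_cong)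
  then show ?thesis
    by (simp only: powr_inverse_cancel(2)[OF assms(2) q] powr_inverse_cancel(2)[OF assms(3) q])
qed

text \<open>The partial sums of a nonnegative series are bounded by \<open>C powr q\<close>. For
  \<open>c0\<close> the analogue fails, as constant sequences show.\<close>

lemma lq_bounded_head_mem:
  assumes "0 < q" "\<And>M. lq_norm q (head M g) \<le> C"
  shows "g \<in> lq q"
proof -
  have "(\<Sum>n<M. g n powr q) \<le> C powr q" for M
    using powr_mono2[of q, OF _ lq_norm_nonneg assms(2)[of M]] assms(1)
    by (simp add: lq_norm_head(2))
  then show ?thesis
    unfolding lq_def using summableI_nonneg_bounded[of "\<lambda>n. g n powr q" "C powr q"] by simp
qed

section \<open>Norms of finite combinations of the basis\<close>

lemma normalized_one_greedy_c0:
  assumes "\<And>n. finite_dim_banach_on (V n) (N n)"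
    and "greedy_basis_on 1 (lp_sum \<infinity> V N) (lp_sum_norm \<infinity> N) x"
    and "\<And>i. lp_sum_norm \<infinity> N (x i) = 1" and "finite S"
  shows "lp_sum_norm \<infinity> N (\<Sum>i\<in>S. a i *\<^sub>R x i) = Max (insert 0 ((\<lambda>i. \<bar>a i\<bar>) ` S))"
proof -
  interpret E: fin_dim_sum c0 sup_norm max V N
    using seq_norm_c0 assms(1) by (intro fin_dim_sum.intro fin_dim_sum_axioms.intro)
  have X: "lp_sum \<infinity> V N = E.X" unfolding E.X_def by (simp add: lp_sum_def c0_def)
  have nr: "lp_sum_norm \<infinity> N = E.nr"
    unfolding fun_eq_iff E.nr_def by (simp add: lp_sum_norm_def sup_norm_def)
  interpret G: greedy_sum c0 sup_norm max V N x
    using assms(2,3) by unfold_locales (simp_all add: X nr)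
  obtain r where r: "strict_mono r" "\<And>n. (\<lambda>k. N n (x (r k) n)) \<longlonglongrightarrow> 0"
    by (rule G.coord_null_subseq_if_max[OF refl]) (rule that)
  show ?thesis
    unfolding nr using \<open>finite S\<close>
  \<comment> \<open>Indices enter in order of increasing absolute coefficient, so
    \<open>add_largest\<close> applies to each new one. The induction rule may insert an index
    already present, hence the case distinction below.\<close>
  proof (induction S rule: finite_ranking_induct[where f = "\<lambda>i. \<bar>a i\<bar>"])
    case empty
    then show ?case by (simp only: sum.empty E.nr_zero) simp
  next
    case (insert i S)
    show ?case
    proof (cases "i \<in> S")
      case True
      then show ?thesis using insert by (simp add: insert_absorb)
    next
      case False
      have "(\<Sum>i\<in>insert i S. a i *\<^sub>R x i) = (\<Sum>i\<in>S. a i *\<^sub>R x i) + a i *\<^sub>R x i"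
        using False insert.hyps by (simp add: add.commute)
      then have "E.nr (\<Sum>i\<in>insert i S. a i *\<^sub>R x i) = max (Max (insert 0 ((\<lambda>i. \<bar>a i\<bar>) ` S))) \<bar>a i\<bar>"
        by (simp only: G.add_largest[OF r insert.hyps(1) False insert.hyps(2)] insert.IH)
      also have "\<dots> = Max (insert \<bar>a i\<bar> (insert 0 ((\<lambda>i. \<bar>a i\<bar>) ` S)))"
        using insert.hyps(1) by (subst (2) Max_insert) (simp_all only: max.commute, auto)
      also have "insert \<bar>a i\<bar> (insert 0 ((\<lambda>i. \<bar>a i\<bar>) ` S)) = insert 0 ((\<lambda>i. \<bar>a i\<bar>) ` insert i S)"
        by auto
      finally show ?thesis .
    qed
  qed
qed

lemma normalized_one_greedy_lp:
  assumes "1 \<le> q" and "\<And>n. finite_dim_banach_on (V n) (N n)"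
    and "greedy_basis_on 1 (lp_sum (ereal q) V N) (lp_sum_norm (ereal q) N) x"
    and "\<And>i. lp_sum_norm (ereal q) N (x i) = 1" and "finite S"
  shows "lp_sum_norm (ereal q) N (\<Sum>i\<in>S. a i *\<^sub>R x i) = (\<Sum>i\<in>S. \<bar>a i\<bar> powr q) powr (1 / q)"
proof -
  have q0: "0 < q" using assms(1) by simp
  interpret E: fin_dim_sum "lq q" "lq_norm q" "lq_pair q" V N
    using seq_norm_lq assms(1,2) by (intro fin_dim_sum.intro fin_dim_sum_axioms.intro)
  have X: "lp_sum (ereal q) V N = E.X" unfolding E.X_def by (simp add: lp_sum_def lq_def)
  have nr: "lp_sum_norm (ereal q) N = E.nr"
    unfolding fun_eq_iff E.nr_def by (simp add: lp_sum_norm_def lq_norm_def)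
  interpret G: greedy_sum "lq q" "lq_norm q" "lq_pair q" V N x
    using assms(3,4) by unfold_locales (simp_all add: X nr)
  obtain r where r: "strict_mono r" "\<And>n. (\<lambda>k. N n (x (r k) n)) \<longlonglongrightarrow> 0"
  proof (rule G.coord_null_subseq_if_injective)
    show "a = b" if "0 \<le> a" "0 \<le> b" "lq_pair q a s = lq_pair q b s" for a b s
      using q0 that by (rule lq_pair_inject)
    show "g \<in> lq q" if "\<And>M. lq_norm q (head M g) \<le> C" for g C
      using q0 that by (rule lq_bounded_head_mem)
  qed (rule that)
  show ?thesis
    unfolding nr using \<open>finite S\<close>
  \<comment> \<open>The same ordering by absolute coefficients; each application of
    \<open>add_largest\<close> now adds one \<open>q\<close>-th power under the root.\<close>
  proof (induction S rule: finite_ranking_induct[where f = "\<lambda>i. \<bar>a i\<bar>"])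
    case empty
    then show ?case by (simp only: sum.empty E.nr_zero) simp
  next
    case (insert i S)
    show ?case
    proof (cases "i \<in> S")
      case True
      then show ?thesis using insert by (simp add: insert_absorb)
    next
      case False
      have "(\<Sum>i\<in>insert i S. a i *\<^sub>R x i) = (\<Sum>i\<in>S. a i *\<^sub>R x i) + a i *\<^sub>R x i"
        using False insert.hyps by (simp add: add.commute)
      then have "E.nr (\<Sum>i\<in>insert i S. a i *\<^sub>R x i) =
          lq_pair q ((\<Sum>i\<in>S. \<bar>a i\<bar> powr q) powr (1 / q)) \<bar>a i\<bar>"
        by (simp only: G.add_largest[OF r insert.hyps(1) False insert.hyps(2)] insert.IH)
      also have "\<dots> = (\<Sum>i\<in>insert i S. \<bar>a i\<bar> powr q) powr (1 / q)"
        using insert.hyps False q0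
        by (simp add: lq_pair_def powr_inverse_cancel sum_nonneg add.commute)
      finally show ?thesis .
    qed
  qed
qed

theorem theorem2:
  fixes p :: ereal
    and V :: "nat \<Rightarrow> 'a::real_vector set"
    and N :: "nat \<Rightarrow> 'a \<Rightarrow> real"
    and x :: "nat \<Rightarrow> nat \<Rightarrow> 'a"
  assumes "1 \<le> p"
    and "\<And>n. finite_dim_banach_on (V n) (N n)"
    and "greedy_basis_on 1 (lp_sum p V N) (lp_sum_norm p N) x"
    and "\<And>i. lp_sum_norm p N (x i) = 1"
  shows "\<forall>a :: nat \<Rightarrow> real. finite {i. a i \<noteq> 0} \<longrightarrow>
    lp_sum_norm p N (\<Sum>i | a i \<noteq> 0. a i *\<^sub>R x i) =
      (if p = \<infinity> then Max (range (\<lambda>i. \<bar>a i\<bar>))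
       else (\<Sum>i | a i \<noteq> 0. \<bar>a i\<bar> powr real_of_ereal p) powr (1 / real_of_ereal p))"
proof (intro allI impI)
  fix a :: "nat \<Rightarrow> real"
  let ?S = "{i. a i \<noteq> 0}"
  assume S: "finite ?S"
  show "lp_sum_norm p N (\<Sum>i\<in>?S. a i *\<^sub>R x i) =
      (if p = \<infinity> then Max (range (\<lambda>i. \<bar>a i\<bar>))
       else (\<Sum>i\<in>?S. \<bar>a i\<bar> powr real_of_ereal p) powr (1 / real_of_ereal p))"
  proof (cases "p = \<infinity>")
    case True
    \<comment> \<open>A coefficient outside the finite support is \<open>0\<close>, so
      \<open>0\<close> belongs to the range and the maximum over the support with \<open>0\<close>
      inserted is the maximum over all indices.\<close>
    obtain j where "a j = 0" using ex_new_if_finite[OF infinite_UNIV_nat S] by auto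
    then have "insert 0 ((\<lambda>i. \<bar>a i\<bar>) ` ?S) = range (\<lambda>i. \<bar>a i\<bar>)"
      by (auto simp: image_iff)
    then show ?thesis
      using normalized_one_greedy_c0[of V N x ?S a] assms(2-4) S True by simp
  next
    case False
    then obtain q where q: "p = ereal q" "1 \<le> q"
      using assms(1) by (cases p) auto
    then show ?thesis
      using normalized_one_greedy_lp[of q V N x ?S a] assms(2-4) S by simp
  qed
qed

end
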